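(* Let $u$ be a preference-zero-sum game. Then the response graph of $u$ has exactly one sink connected component, and consequently the replicator flow of $u$ has precisely one sink chain component.
   Context: Games. A (finite) game has players $1,\dots,N$, finite non-empty strategy sets $S_1,\dots,S_N$ and a utility function $u:Z\to\mathbb{R}^N$, where $Z=\prod_{i=1}^N S_i$ is the set of (pure) profiles. Two profiles are $i$-comparable if they differ exactly in the strategy of player $i$. The response graph is the directed graph with node set $Z$ and an arc $p\to q$ if and only if $p,q$ are $i$-comparable for some $i$ and $u_i(p)\le u_i(q)$. A set of nodes is attracting if no path (equivalently no arc) leaves it; the sink connected components are the minimal non-empty attracting sets, i.e. the strongly connected components with no outgoing arc. A two-player game is zero-sum if $u_1+u_2=0$. A game is preference-zero-sum if its response graph is isomorphic (as a directed graph) to the response graph of a two-player zero-sum game. The strategy space is $X=\prod_{i=1}^N\Delta_{|S_i|}$, where $\Delta_{|S_i|}$ is the simplex of probability distributions on $S_i$. For $x\in X$, $x^i_s$ is the probability player $i$ gives to $s\in S_i$. The expected utility is $\mathbb{U}(x)=\sum_{q\in Z}u(q)\prod_{i=1}^N x^i_{q_i}$, and $\mathbb{U}_p(s;\bar x_{-p})$ denotes player $p$'s expected utility when $p$ plays $s$ and the others play according to $x$. Replicator flow. The replicator flow $\phi:X\times\mathbb{R}\to X$ is the flow of the ODE $\dot x^p_s=x^p_s\bigl(\mathbb{U}_p(s;\bar x_{-p})-\sum_{t\in S_p}x^p_t\,\mathbb{U}_p(t;\bar x_{-p})\bigr)$. Chains. Let $\mathbf{d}$ be the Euclidean metric on $X$.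 For $\epsilon,T>0$, an $(\epsilon,T)$-chain from $x$ to $y$ is a finite sequence $x=x_1,x_2,\dots,x_n=y$ with $n\ge 2$ and times $t_1,\dots,t_{n-1}\ge T$ such that $\mathbf{d}(\phi(x_i,t_i),x_{i+1})<\epsilon$ for $1\le i\le n-1$. There is a pseudo-orbit from $x$ to $y$ if there is an $(\epsilon,T)$-chain from $x$ to $y$ for all $\epsilon>0$ and $T>0$. Points $x,y$ are chain equivalent if there are pseudo-orbits from $x$ to $y$ and from $y$ to $x$; $x$ is chain recurrent if it is chain equivalent to itself. Chain equivalence is an equivalence relation on the chain recurrent points; its classes are the chain components. Pseudo-orbits induce a partial order on chain components; a sink chain component is a minimal one, i.e. a chain component $C$ such that whenever $c\in C$, $z$ is chain recurrent and there is a pseudo-orbit from $c$ to $z$, then $z\in C$. *)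

theory Defs
  imports
    "Graph_Theory.Digraph_Isomorphism"
    "Graph_Theory.Pair_Digraph"
    "HOL-Analysis.Analysis"
begin

section \<open>Games and response graphs\<close>

text \<open>
  Players are the elements of a finite type \<open>'n\<close>; player \<open>i\<close> has the strategy set \<open>S i\<close>, a subset
  of one common type \<open>'s\<close>, so different players may have different numbers of strategies.
\<close>

definition game :: "('n::finite \<Rightarrow> 's set) \<Rightarrow> bool" where
  "game S \<longleftrightarrow> (\<forall>i. finite (S i) \<and> S i \<noteq> {})"

definition profiles :: "('n \<Rightarrow> 's set) \<Rightarrow> ('n \<Rightarrow> 's) set" where
  "profiles S = {q. \<forall>i. q i \<in> S i}"

definition comparable :: "'n \<Rightarrow> ('n \<Rightarrow> 's) \<Rightarrow> ('n \<Rightarrow> 's) \<Rightarrow> bool" where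
  "comparable i p q \<longleftrightarrow> p i \<noteq> q i \<and> (\<forall>j. j \<noteq> i \<longrightarrow> p j = q j)"

definition response_graph ::
    "('n::finite \<Rightarrow> 's set) \<Rightarrow> (('n \<Rightarrow> 's) \<Rightarrow> real^'n) \<Rightarrow> ('n \<Rightarrow> 's, ('n \<Rightarrow> 's) \<times> ('n \<Rightarrow> 's)) pre_digraph"
  where
  "response_graph S u = with_proj
     \<lparr> pverts = profiles S,
       parcs = {(p, q). p \<in> profiles S \<and> q \<in> profiles S \<and>
                        (\<exists>i. comparable i p q \<and> u p $ i \<le> u q $ i)} \<rparr>"

definition attracting :: "('a, 'b) pre_digraph \<Rightarrow> 'a set \<Rightarrow> bool" where
  "attracting G A \<longleftrightarrow> A \<subseteq> verts G \<and> (\<forall>p\<in>A. \<forall>q. p \<rightarrow>\<^sup>*\<^bsub>G\<^esub> q \<longrightarrow> q \<in> A)"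

definition sink_connected_component :: "('a, 'b) pre_digraph \<Rightarrow> 'a set \<Rightarrow> bool" where
  "sink_connected_component G H \<longleftrightarrow>
     attracting G H \<and> H \<noteq> {} \<and> (\<forall>A. attracting G A \<and> A \<noteq> {} \<and> A \<subseteq> H \<longrightarrow> A = H)"

definition zero_sum :: "(2 \<Rightarrow> 's set) \<Rightarrow> ((2 \<Rightarrow> 's) \<Rightarrow> real^2) \<Rightarrow> bool" where
  "zero_sum S u \<longleftrightarrow> (\<forall>q\<in>profiles S. u q $ 1 + u q $ 2 = 0)"

text \<open>
  The zero-sum game may be assumed to have natural numbers as strategies, since its strategy sets
  are finite and renaming strategies does not change the response graph up to isomorphism.
\<close>

definition preference_zero_sum :: "('n::finite \<Rightarrow> 's set) \<Rightarrow> (('n \<Rightarrow> 's) \<Rightarrow> real^'n) \<Rightarrow> bool" where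
  "preference_zero_sum S u \<longleftrightarrow>
     (\<exists>(S' :: 2 \<Rightarrow> nat set) (u' :: (2 \<Rightarrow> nat) \<Rightarrow> real^2).
        game S' \<and> zero_sum S' u' \<and> digraph_iso (response_graph S u) (response_graph S' u'))"


section \<open>Mixed strategies and the replicator flow\<close>

text \<open>
  The coordinate \<open>x $ i $ s\<close> is the probability that player \<open>i\<close> gives to \<open>s\<close>. Coordinates with
  \<open>s \<notin> S i\<close> are zero, so \<open>dist\<close> on \<open>real^'s^'n\<close> restricts to the Euclidean metric on the product of
  the simplices.
\<close>

definition strategy_space :: "('n::finite \<Rightarrow> 's::finite set) \<Rightarrow> (real^'s^'n) set" where
  "strategy_space S =
     {x. \<forall>i. (\<forall>s. 0 \<le> x $ i $ s) \<and> (\<forall>s. s \<notin> S i \<longrightarrow> x $ i $ s = 0) \<and> (\<Sum>s\<in>S i. x $ i $ s) = 1}"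

definition expected_utility ::
    "('n::finite \<Rightarrow> 's::finite set) \<Rightarrow> (('n \<Rightarrow> 's) \<Rightarrow> real^'n) \<Rightarrow> real^'s^'n \<Rightarrow> real^'n" where
  "expected_utility S u x = (\<Sum>q\<in>profiles S. (\<Prod>i\<in>UNIV. x $ i $ q i) *\<^sub>R u q)"

definition play_pure :: "real^'s^'n \<Rightarrow> 'n::finite \<Rightarrow> 's::finite \<Rightarrow> real^'s^'n" where
  "play_pure x p s = (\<chi> i. if i = p then axis s 1 else x $ i)"

definition expected_pure ::
    "('n::finite \<Rightarrow> 's::finite set) \<Rightarrow> (('n \<Rightarrow> 's) \<Rightarrow> real^'n) \<Rightarrow> 'n \<Rightarrow> 's \<Rightarrow> real^'s^'n \<Rightarrow> real" where
  "expected_pure S u p s x = expected_utility S u (play_pure x p s) $ p"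

definition replicator_field ::
    "('n::finite \<Rightarrow> 's::finite set) \<Rightarrow> (('n \<Rightarrow> 's) \<Rightarrow> real^'n) \<Rightarrow> real^'s^'n \<Rightarrow> real^'s^'n" where
  "replicator_field S u x =
     (\<chi> p s. x $ p $ s * (expected_pure S u p s x - (\<Sum>t\<in>S p. x $ p $ t * expected_pure S u p t x)))"

definition flow_on :: "'a::topological_space set \<Rightarrow> ('a \<Rightarrow> real \<Rightarrow> 'a) \<Rightarrow> bool" where
  "flow_on X \<phi> \<longleftrightarrow>
     (\<forall>x\<in>X. \<forall>t. \<phi> x t \<in> X) \<and>
     continuous_on (X \<times> UNIV) (\<lambda>(x, t). \<phi> x t) \<and>
     (\<forall>x\<in>X. \<phi> x 0 = x) \<and>
     (\<forall>x\<in>X. \<forall>s t. \<phi> (\<phi> x s) t = \<phi> x (s + t))"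

text \<open>
  The replicator field is polynomial and leaves the compact set \<open>strategy_space S\<close> invariant, so this
  predicate is satisfiable and determines \<open>\<phi>\<close> uniquely on \<open>strategy_space S \<times> UNIV\<close>; values of \<open>\<phi>\<close>
  elsewhere are never used.
\<close>

definition replicator_flow ::
    "('n::finite \<Rightarrow> 's::finite set) \<Rightarrow> (('n \<Rightarrow> 's) \<Rightarrow> real^'n) \<Rightarrow> (real^'s^'n \<Rightarrow> real \<Rightarrow> real^'s^'n) \<Rightarrow> bool"
  where
  "replicator_flow S u \<phi> \<longleftrightarrow>
     flow_on (strategy_space S) \<phi> \<and>
     (\<forall>x\<in>strategy_space S. \<forall>t. (\<phi> x has_vector_derivative replicator_field S u (\<phi> x t)) (at t))"


section \<open>Chain components\<close>

definition chain_from_to ::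
    "'a::metric_space set \<Rightarrow> ('a \<Rightarrow> real \<Rightarrow> 'a) \<Rightarrow> real \<Rightarrow> real \<Rightarrow> 'a \<Rightarrow> 'a \<Rightarrow> bool" where
  "chain_from_to X \<phi> \<epsilon> T x y \<longleftrightarrow>
     (\<exists>n\<ge>2. \<exists>(z :: nat \<Rightarrow> 'a) (\<tau> :: nat \<Rightarrow> real).
        z 1 = x \<and> z n = y \<and> (\<forall>i\<in>{1..n}. z i \<in> X) \<and>
        (\<forall>i\<in>{1..n - 1}. \<tau> i \<ge> T \<and> dist (\<phi> (z i) (\<tau> i)) (z (i + 1)) < \<epsilon>))"

definition pseudo_orbit ::
    "'a::metric_space set \<Rightarrow> ('a \<Rightarrow> real \<Rightarrow> 'a) \<Rightarrow> 'a \<Rightarrow> 'a \<Rightarrow> bool" where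
  "pseudo_orbit X \<phi> x y \<longleftrightarrow> (\<forall>\<epsilon>>0. \<forall>T>0. chain_from_to X \<phi> \<epsilon> T x y)"

definition chain_equivalent ::
    "'a::metric_space set \<Rightarrow> ('a \<Rightarrow> real \<Rightarrow> 'a) \<Rightarrow> 'a \<Rightarrow> 'a \<Rightarrow> bool" where
  "chain_equivalent X \<phi> x y \<longleftrightarrow> pseudo_orbit X \<phi> x y \<and> pseudo_orbit X \<phi> y x"

definition chain_recurrent_set ::
    "'a::metric_space set \<Rightarrow> ('a \<Rightarrow> real \<Rightarrow> 'a) \<Rightarrow> 'a set" where
  "chain_recurrent_set X \<phi> = {x \<in> X. chain_equivalent X \<phi> x x}"

definition chain_components ::
    "'a::metric_space set \<Rightarrow> ('a \<Rightarrow> real \<Rightarrow> 'a) \<Rightarrow> 'a set set" where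
  "chain_components X \<phi> =
     chain_recurrent_set X \<phi> //
       {(x, y). x \<in> chain_recurrent_set X \<phi> \<and> y \<in> chain_recurrent_set X \<phi> \<and> chain_equivalent X \<phi> x y}"

definition sink_chain_component ::
    "'a::metric_space set \<Rightarrow> ('a \<Rightarrow> real \<Rightarrow> 'a) \<Rightarrow> 'a set \<Rightarrow> bool" where
  "sink_chain_component X \<phi> C \<longleftrightarrow>
     C \<in> chain_components X \<phi> \<and>
     (\<forall>c\<in>C. \<forall>z\<in>chain_recurrent_set X \<phi>. pseudo_orbit X \<phi> c z \<longrightarrow> z \<in> C)"

end

theory Submission
  imports Defs
begin

text \<open>
  Two non-empty attracting sets of the response graph of a two-player zero-sum game always meet, so
  there is only one sink component, and every profile reaches all of it.

  An arc of the response graph gives a pseudo-orbit between the corresponding pure profiles: along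
  the edge joining them, the flow never decreases the weight of the better reply, and jumps of size
  \<open>\<epsilon>\<close> increase it. It remains to see that every mixed profile \<open>x\<close> has chains to pure profiles, that
  is, by induction, chains to profiles of smaller support. On the open face containing \<open>x\<close> the
  replicator equation becomes, in the coordinates \<open>ln (x\<^sub>s / x\<^sub>b)\<close>, a field no component of which depends
  on its own coordinate. Such a field is divergence-free, and a set that is bounded away from the
  boundary of the face and contains the \<open>\<epsilon>\<close>-neighbourhood of its image under the flow would
  contradict volume preservation. The volume argument is carried out by counting points of a fine
  grid, which a rounded splitting scheme approximating the flow permutes.
\<close>

section \<open>Response graphs\<close>

lemma verts_response_graph [simp]: "verts (response_graph S u) = profiles S"
  by (simp add: response_graph_def)

lemma dominates_response_graph_iff:
  "p \<rightarrow>\<^bsub>response_graph S u\<^esub> q \<longleftrightarrow>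
     p \<in> profiles S \<and> q \<in> profiles S \<and> (\<exists>i. comparable i p q \<and> u p $ i \<le> u q $ i)"
  by (auto simp: response_graph_def arcs_ends_def arc_to_ends_def)

lemma finite_profiles:
  fixes S :: "'n::finite \<Rightarrow> 's set"
  assumes "game S"
  shows "finite (profiles S)"
proof -
  have "profiles S = (\<Pi>\<^sub>E i\<in>UNIV. S i)"
    by (auto simp: profiles_def PiE_def Pi_def extensional_def)
  then show ?thesis
    using assms by (auto simp: game_def intro: finite_PiE)
qed

lemma profiles_nonempty:
  assumes "game S"
  shows "profiles S \<noteq> {}"
proof -
  have "(\<lambda>i. SOME s. s \<in> S i) \<in> profiles S"
    using assms by (auto simp: game_def profiles_def some_in_eq)
  then show ?thesis by auto
qed

section \<open>Attracting sets: arcs, intersections, isomorphisms\<close>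

lemma attractingD:
  assumes "attracting G A" "p \<in> A" "q \<in> verts G" "p \<rightarrow>\<^bsub>G\<^esub> q"
  shows "q \<in> A"
proof -
  have "p \<rightarrow>\<^sup>*\<^bsub>G\<^esub> q"
    unfolding reachable_def
    using assms by (auto simp: attracting_def intro: rtrancl_on_into_rtrancl_on)
  then show ?thesis
    using assms by (auto simp: attracting_def)
qed

lemma attractingI:
  assumes "A \<subseteq> verts G" "\<And>p q. p \<in> A \<Longrightarrow> p \<rightarrow>\<^bsub>G\<^esub> q \<Longrightarrow> q \<in> A"
  shows "attracting G A"
proof -
  have "q \<in> A" if "p \<in> A" "p \<rightarrow>\<^sup>*\<^bsub>G\<^esub> q" for p q
    using that(2,1) unfolding reachable_def
    by (induction rule: rtrancl_on_induct) (auto intro: assms)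
  then show ?thesis
    using assms(1) by (auto simp: attracting_def)
qed

lemma attracting_reachable_set:
  assumes "p \<in> verts G"
  shows "attracting G {q. p \<rightarrow>\<^sup>*\<^bsub>G\<^esub> q}"
  unfolding attracting_def reachable_def
  by (auto intro: rtrancl_on_trans dest: in_rtrancl_on_in_F)

lemma attracting_Int:
  "attracting G A \<Longrightarrow> attracting G B \<Longrightarrow> attracting G (A \<inter> B)"
  unfolding attracting_def by blast

text \<open>Lets attracting sets of a preference-zero-sum game be compared inside its zero-sum
  model, where the payoffs can be added up.\<close>

lemma attracting_image_iso:
  assumes iso: "pre_digraph.digraph_isomorphism G f" and A: "attracting G A"
  shows "attracting (app_iso f G) (iso_verts f ` A)"
proof (rule attractingI)
  show "iso_verts f ` A \<subseteq> verts (app_iso f G)"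
    using A by (auto simp: attracting_def)
next
  fix p q
  assume "p \<in> iso_verts f ` A" and "p \<rightarrow>\<^bsub>app_iso f G\<^esub> q"
  then obtain p' e where p': "p' \<in> A" "p = iso_verts f p'" and e: "e \<in> arcs G"
    "p = iso_tail f (iso_arcs f e)" "q = iso_head f (iso_arcs f e)"
    by (auto simp: arcs_ends_def arc_to_ends_def)
  interpret wf_digraph G
    using iso by (simp add: pre_digraph.digraph_isomorphism_def)
  have "iso_verts f p' = iso_verts f (tail G e)"
    using e p' iso by (simp add: iso_verts_tail)
  moreover have "p' \<in> verts G" "tail G e \<in> verts G"
    using p' A e by (auto simp: attracting_def)
  ultimately have "p' = tail G e"
    using iso by simp
  then have "p' \<rightarrow>\<^bsub>G\<^esub> head G e"
    using e by (auto simp: arcs_ends_def arc_to_ends_def)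
  then have "head G e \<in> A"
    using A p' e by (auto intro: attractingD)
  then show "q \<in> iso_verts f ` A"
    using e iso by (auto simp: iso_verts_head)
qed

text \<open>
  Comparable profiles are always joined by an arc, so disjoint attracting sets contain no
  comparable profiles. The two profiles mixing a profile of one set with one of the other
  therefore lie in neither set, and the four strict inequalities this yields add up to a
  contradiction with the zero-sum condition.
\<close>

lemma zero_sum_attracting_Int_nonempty:
  fixes u :: "(2 \<Rightarrow> 's) \<Rightarrow> real^2"
  assumes zs: "zero_sum S u"
    and A: "attracting (response_graph S u) A" "A \<noteq> {}"
    and B: "attracting (response_graph S u) B" "B \<noteq> {}"
  shows "A \<inter> B \<noteq> {}"
proof
  assume disj: "A \<inter> B = {}"
  obtain p k where p: "p \<in> A" and k: "k \<in> B"
    using A B by auto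
  have sub: "A \<subseteq> profiles S" "B \<subseteq> profiles S"
    using A B by (auto simp: attracting_def)
  \<comment> \<open>No arc leaves an attracting set, so a player who deviates out of it strictly
    loses.\<close>
  have out: "u a $ i > u b $ i"
    if "attracting (response_graph S u) C" "a \<in> C" "b \<in> profiles S" "b \<notin> C" "comparable i a b"
    for C a b i
  proof (rule ccontr)
    assume "\<not> u a $ i > u b $ i"
    then have "a \<rightarrow>\<^bsub>response_graph S u\<^esub> b"
      using that by (auto simp: dominates_response_graph_iff attracting_def not_less)
    then show False
      using attractingD[OF that(1,2)] that by auto
  qed
  have ncomp: "\<not> comparable i a b" if "a \<in> A" "b \<in> B" for i a b
  proof
    assume "comparable i a b"
    moreover from this have "comparable i b a"
      by (auto simp: comparable_def)
    ultimately have "u a $ i > u b $ i" "u b $ i > u a $ i"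
      using out A B that disj sub by blast+
    then show False by simp
  qed
  define v where "v = p(2 := k 2)"
  define w where "w = k(2 := p 2)"
  have two: "a = b \<longleftrightarrow> a 1 = b 1 \<and> a 2 = b 2" for a b :: "2 \<Rightarrow> 's"
    by (metis exhaust_2 ext)
  \<comment> \<open>Agreement in one coordinate would make \<open>a\<close> and \<open>b\<close>
    equal or comparable.\<close>
  have ne: "a 1 \<noteq> b 1" "a 2 \<noteq> b 2" if "a \<in> A" "b \<in> B" for a b
    using ncomp[OF that, of 1] ncomp[OF that, of 2] disj that two
    by (auto simp: comparable_def) (metis exhaust_2 disjoint_iff two)+
  have vw: "v \<in> profiles S" "w \<in> profiles S"
    using p k sub by (auto simp: v_def w_def profiles_def)
  have "v \<notin> A" "v \<notin> B" "w \<notin> A" "w \<notin> B"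
    using ne[OF p, of v] ne[of w, OF _ k] ne[of v, OF _ k] ne[OF p, of w]
    by (auto simp: v_def w_def)
  moreover have "comparable 2 p v" "comparable 1 k v" "comparable 1 p w" "comparable 2 k w"
    using ne[OF p k] by (auto simp: v_def w_def comparable_def) (metis exhaust_2)+
  \<comment> \<open>Each of the eight payoffs at \<open>p\<close>, \<open>k\<close>,
    \<open>v\<close>, \<open>w\<close> occurs exactly once here, so the sum of the four inequalities
    reads \<open>0 > 0\<close>.\<close>
  ultimately have "u p $ 2 > u v $ 2" "u k $ 1 > u v $ 1" "u p $ 1 > u w $ 1" "u k $ 2 > u w $ 2"
    using out A B p k vw by blast+
  moreover have "u q $ 1 + u q $ 2 = 0" if "q \<in> {p, k, v, w}" for q
    using zs that vw p k sub by (auto simp: zero_sum_def)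
  then have "u p $ 1 + u p $ 2 = 0" "u k $ 1 + u k $ 2 = 0"
    "u v $ 1 + u v $ 2 = 0" "u w $ 1 + u w $ 2 = 0"
    by auto
  ultimately show False by linarith
qed

lemma preference_zero_sum_attracting_Int_nonempty:
  assumes "preference_zero_sum S u"
    and A: "attracting (response_graph S u) A" "A \<noteq> {}"
    and B: "attracting (response_graph S u) B" "B \<noteq> {}"
  shows "A \<inter> B \<noteq> {}"
proof -
  obtain S' :: "2 \<Rightarrow> nat set" and u' f
    where zs: "zero_sum S' u'"
      and iso: "pre_digraph.digraph_isomorphism (response_graph S u) f"
      and eq: "response_graph S' u' = app_iso f (response_graph S u)"
    using assms(1) unfolding preference_zero_sum_def digraph_iso_def by blast
  have "iso_verts f ` A \<inter> iso_verts f ` B \<noteq> {}"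
    using A B attracting_image_iso[OF iso]
    by (intro zero_sum_attracting_Int_nonempty[OF zs]) (simp_all add: eq)
  then obtain a b where "a \<in> A" "b \<in> B" "iso_verts f a = iso_verts f b"
    by auto
  moreover have "a \<in> verts (response_graph S u)" "b \<in> verts (response_graph S u)"
    using calculation A B by (auto simp only: attracting_def)
  ultimately show ?thesis
    using pre_digraph.iso_verts_eq_iff[OF iso] by blast
qed

text \<open>Finiteness provides a minimal attracting set. Two minimal ones meet in a non-empty
  attracting set, which by minimality equals both.\<close>

lemma ex1_sink_connected_component:
  assumes "finite (verts G)" "verts G \<noteq> {}"
    and Int: "\<And>A B. attracting G A \<Longrightarrow> A \<noteq> {} \<Longrightarrow> attracting G B \<Longrightarrow> B \<noteq> {} \<Longrightarrow> A \<inter> B \<noteq> {}"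
  shows "\<exists>!H. sink_connected_component G H"
proof -
  let ?P = "{A. attracting G A \<and> A \<noteq> {}}"
  have "?P \<subseteq> Pow (verts G)"
    by (auto simp: attracting_def)
  then have "finite ?P"
    using assms(1) by (meson finite_Pow_iff finite_subset)
  moreover have "verts G \<in> ?P"
    using assms(2) by (auto simp: attracting_def reachable_def dest: in_rtrancl_on_in_F)
  ultimately obtain H where "H \<in> ?P" and "\<forall>A\<in>?P. A \<subseteq> H \<longrightarrow> H = A"
    using finite_has_minimal[of ?P] by blast
  then have "sink_connected_component G H"
    by (auto simp: sink_connected_component_def)
  moreover have "H = K" if "sink_connected_component G H" "sink_connected_component G K" for H K
    using that Int[of H K] attracting_Int[of G H K] unfolding sink_connected_component_def
    by (metis inf_le1 inf_le2)
  ultimately show ?thesis by blast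
qed

text \<open>The set of vertices reachable from \<open>p\<close> is attracting, so it meets
  \<open>H\<close>; minimality of \<open>H\<close> turns this into inclusion of all of
  \<open>H\<close>.\<close>

lemma sink_connected_component_reachable:
  assumes H: "sink_connected_component G H"
    and Int: "\<And>A B. attracting G A \<Longrightarrow> A \<noteq> {} \<Longrightarrow> attracting G B \<Longrightarrow> B \<noteq> {} \<Longrightarrow> A \<inter> B \<noteq> {}"
    and "h \<in> H" "p \<in> verts G"
  shows "p \<rightarrow>\<^sup>*\<^bsub>G\<^esub> h"
proof -
  let ?R = "{q. p \<rightarrow>\<^sup>*\<^bsub>G\<^esub> q}"
  have R: "attracting G ?R" "?R \<noteq> {}"
    using attracting_reachable_set[OF assms(4)] assms(4) by (auto simp: reachable_def)
  have "attracting G (?R \<inter> H)" "?R \<inter> H \<noteq> {}"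
    using R H Int[of ?R H] attracting_Int[of G ?R H] by (auto simp: sink_connected_component_def)
  then have "?R \<inter> H = H"
    using H by (auto simp: sink_connected_component_def)
  then show ?thesis
    using assms(3) by auto
qed


section \<open>Chains\<close>

text \<open>A single jump of a chain, so that chains become paths of a relation and closure
  operators apply.\<close>

definition chain_step ::
    "'a::metric_space set \<Rightarrow> ('a \<Rightarrow> real \<Rightarrow> 'a) \<Rightarrow> real \<Rightarrow> real \<Rightarrow> 'a \<Rightarrow> 'a \<Rightarrow> bool" where
  "chain_step X \<phi> \<epsilon> T x y \<longleftrightarrow> x \<in> X \<and> y \<in> X \<and> (\<exists>t\<ge>T. dist (\<phi> x t) y < \<epsilon>)"

text \<open>A chain of \<open>n\<close> points indexed from 1 is a path of \<open>n - 1\<close>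
  steps indexed from 0. The condition \<open>n \<ge> 2\<close> demands at least one step, hence the
  transitive and not the reflexive closure.\<close>

lemma chain_from_to_iff_tranclp:
  "chain_from_to X \<phi> \<epsilon> T x y \<longleftrightarrow> (chain_step X \<phi> \<epsilon> T)\<^sup>+\<^sup>+ x y"
proof
  assume "chain_from_to X \<phi> \<epsilon> T x y"
  then obtain n :: nat and z \<tau> where n: "n \<ge> 2" and z: "z 1 = x" "z n = y" "\<forall>i\<in>{1..n}. z i \<in> X"
    and st: "\<forall>i\<in>{1..n - 1}. \<tau> i \<ge> T \<and> dist (\<phi> (z i) (\<tau> i)) (z (i + 1)) < \<epsilon>"
    unfolding chain_from_to_def by blast
  have "chain_step X \<phi> \<epsilon> T (z (Suc i)) (z (Suc (Suc i)))" if "i < n - 1" for i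
  proof -
    have "Suc i \<in> {1..n - 1}" "Suc i \<in> {1..n}" "Suc (Suc i) \<in> {1..n}"
      using that by auto
    then show ?thesis
      unfolding chain_step_def using z(3) st by (metis Suc_eq_plus1)
  qed
  then have "(chain_step X \<phi> \<epsilon> T ^^ (n - 1)) x y"
    unfolding relpowp_fun_conv using z n by (intro exI[of _ "\<lambda>i. z (Suc i)"]) auto
  then show "(chain_step X \<phi> \<epsilon> T)\<^sup>+\<^sup>+ x y"
    using n unfolding tranclp_power by (intro exI[of _ "n - 1"]) auto
next
  assume "(chain_step X \<phi> \<epsilon> T)\<^sup>+\<^sup>+ x y"
  then obtain n z where n: "n > 0" and z: "z 0 = x" "z n = y"
    and "\<forall>i<n. chain_step X \<phi> \<epsilon> T (z i) (z (Suc i))"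
    unfolding tranclp_power relpowp_fun_conv by blast
  then obtain \<tau> where st: "\<And>i. i < n \<Longrightarrow> z i \<in> X \<and> z (Suc i) \<in> X \<and> \<tau> i \<ge> T \<and>
      dist (\<phi> (z i) (\<tau> i)) (z (Suc i)) < \<epsilon>"
    unfolding chain_step_def by metis
  have "z i \<in> X" if "i \<le> n" for i
    using st[of i] st[of "i - 1"] that n by (cases "i < n") auto
  moreover have "\<tau> (i - 1) \<ge> T \<and> dist (\<phi> (z (i - 1)) (\<tau> (i - 1))) (z (i + 1 - 1)) < \<epsilon>"
    if "i \<in> {1..Suc n - 1}" for i
    using st[of "i - 1"] that by auto
  ultimately show "chain_from_to X \<phi> \<epsilon> T x y"
    unfolding chain_from_to_def using n z
    by (intro exI[of _ "Suc n"] conjI exI[of _ "\<lambda>i. z (i - 1)"] exI[of _ "\<lambda>i. \<tau> (i - 1)"]) auto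
qed

lemma pseudo_orbit_trans:
  "pseudo_orbit X \<phi> x y \<Longrightarrow> pseudo_orbit X \<phi> y z \<Longrightarrow> pseudo_orbit X \<phi> x z"
  unfolding pseudo_orbit_def chain_from_to_iff_tranclp by (meson tranclp_trans)

lemma equiv_chain_equivalent:
  "equiv (chain_recurrent_set X \<phi>)
     {(x, y). x \<in> chain_recurrent_set X \<phi> \<and> y \<in> chain_recurrent_set X \<phi> \<and> chain_equivalent X \<phi> x y}"
  by (intro equivI refl_onI symI transI)
    (auto simp: chain_recurrent_set_def chain_equivalent_def intro: pseudo_orbit_trans)

text \<open>The case \<open>x = p\<close> makes \<open>p\<close> chain recurrent. Its class is a
  sink because whatever it reaches leads back to \<open>p\<close>, and every sink class reaches
  \<open>p\<close> and so contains it.\<close>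

lemma ex1_sink_chain_component:
  assumes p: "p \<in> X" and to_p: "\<And>x. x \<in> X \<Longrightarrow> pseudo_orbit X \<phi> x p"
  shows "\<exists>!C. sink_chain_component X \<phi> C"
proof
  let ?R = "chain_recurrent_set X \<phi>"
  let ?r = "{(x, y). x \<in> ?R \<and> y \<in> ?R \<and> chain_equivalent X \<phi> x y}"
  have p_rec: "p \<in> ?R"
    using p to_p by (auto simp: chain_recurrent_set_def chain_equivalent_def)
  have rec_X: "x \<in> X" if "x \<in> ?R" for x
    using that by (auto simp: chain_recurrent_set_def)
  show "sink_chain_component X \<phi> (?r `` {p})"
    unfolding sink_chain_component_def chain_components_def
  proof (intro conjI ballI impI)
    show "?r `` {p} \<in> ?R // ?r"
      using p_rec by (rule quotientI)
  next
    fix c z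
    assume "c \<in> ?r `` {p}" "z \<in> ?R" "pseudo_orbit X \<phi> c z"
    then show "z \<in> ?r `` {p}"
      using to_p[OF rec_X[of z]] by (auto simp: chain_equivalent_def intro: pseudo_orbit_trans)
  qed
  show "C = ?r `` {p}" if C: "sink_chain_component X \<phi> C" for C
  proof -
    obtain c where c: "c \<in> ?R" "C = ?r `` {c}"
      using C unfolding sink_chain_component_def chain_components_def by (auto elim: quotientE)
    have "c \<in> C"
      using c by (auto simp: chain_recurrent_set_def)
    then have "p \<in> C"
      using C p_rec to_p rec_X c(1) unfolding sink_chain_component_def by blast
    then have "(c, p) \<in> ?r"
      using c by auto
    then show ?thesis
      using c equiv_class_eq[OF equiv_chain_equivalent] by blast
  qed
qed

section \<open>Grid bijections approximating a divergence-free flow\<close>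

definition grid_point :: "real \<Rightarrow> ('c \<Rightarrow> int) \<Rightarrow> 'c \<Rightarrow> real" where
  "grid_point \<eta> k = (\<lambda>c. \<eta> * real_of_int (k c))"

text \<open>\<open>own_indep\<close> is a form of zero divergence that needs no derivatives:
  changing one coordinate by its field component is a shear. The Lipschitz condition refers to the
  maximum norm.\<close>

locale shear_field =
  fixes f :: "'c::finite \<Rightarrow> ('c \<Rightarrow> real) \<Rightarrow> real" and M L :: real
  assumes bound: "\<bar>f c y\<bar> \<le> M"
    and lipschitz: "(\<And>d. \<bar>y d - z d\<bar> \<le> e) \<Longrightarrow> \<bar>f c y - f c z\<bar> \<le> L * e"
    and own_indep: "f c (y(c := v)) = f c y"
    and L_pos: "L > 0"
begin

lemma M_nonneg: "M \<ge> 0"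
  using bound[of undefined undefined] by linarith

text \<open>The Euler increment is rounded down to whole grid units, so that injectivity becomes an
  exact statement about integer tuples.\<close>

definition shear :: "real \<Rightarrow> real \<Rightarrow> 'c \<Rightarrow> ('c \<Rightarrow> int) \<Rightarrow> 'c \<Rightarrow> int" where
  "shear \<eta> h c k = k(c := k c + \<lfloor>h * f c (grid_point \<eta> k) / \<eta>\<rfloor>)"

text \<open>The image agrees with the argument off \<open>c\<close>, and by \<open>own_indep\<close>
  those coordinates already determine the increment.\<close>

lemma inj_shear: "inj (shear \<eta> h c)"
proof (rule injI)
  fix k l
  assume eq: "shear \<eta> h c k = shear \<eta> h c l"
  have off: "k d = l d" if "d \<noteq> c" for d
    using fun_cong[OF eq, of d] that by (simp add: shear_def)
  have "grid_point \<eta> k = (grid_point \<eta> l)(c := grid_point \<eta> k c)"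
    by (auto simp: grid_point_def off)
  then have "f c (grid_point \<eta> k) = f c (grid_point \<eta> l)"
    by (metis own_indep)
  then have "k c = l c"
    using fun_cong[OF eq, of c] by (simp add: shear_def)
  then show "k = l"
    using off by (metis ext)
qed

lemma inj_fold_shear: "inj (fold (shear \<eta> h) cs)"
proof (induction cs)
  case (Cons c cs)
  then show ?case
    using inj_compose[OF Cons.IH inj_shear] by (simp add: comp_def)
qed simp

text \<open>Rounding zero gives exactly zero, so coordinates that are to stay pinned are not
  disturbed.\<close>

lemma shear_fixed:
  assumes "\<And>y. f c y = 0"
  shows "shear \<eta> h d k c = k c"
  using assms by (auto simp: shear_def)

lemma fold_shear_fixed:
  assumes "\<And>y. f c y = 0"
  shows "fold (shear \<eta> h) cs k c = k c"
  by (induction cs arbitrary: k) (simp_all add: shear_fixed assms)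

text \<open>Each coordinate is updated once. At its turn it still has its initial value, while the
  others have moved by at most \<open>D\<close>; this costs \<open>h * L * D\<close> in the field,
  and rounding costs \<open>\<eta>\<close>. The first and third conjunct carry the
  induction.\<close>

lemma fold_shear_error:
  assumes "distinct cs" "\<eta> > 0" "h \<ge> 0"
  defines "D \<equiv> M * h + \<eta>"
  shows "(c \<notin> set cs \<longrightarrow> fold (shear \<eta> h) cs k c = k c) \<and>
    (c \<in> set cs \<longrightarrow>
      \<bar>grid_point \<eta> (fold (shear \<eta> h) cs k) c - grid_point \<eta> k c - h * f c (grid_point \<eta> k)\<bar> \<le> h * L * D + \<eta>) \<and>
    \<bar>grid_point \<eta> (fold (shear \<eta> h) cs k) c - grid_point \<eta> k c\<bar> \<le> D"
  using assms(1)
proof (induction cs arbitrary: c rule: rev_induct)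
  case Nil
  then show ?case
    using assms M_nonneg by simp
next
  case (snoc d cs)
  let ?k = "fold (shear \<eta> h) cs k"
  have step: "fold (shear \<eta> h) (cs @ [d]) k = shear \<eta> h d ?k"
    by simp
  show ?case
  proof (cases "c = d")
    case False
    have "shear \<eta> h d ?k c = ?k c"
      using False by (simp add: shear_def)
    then show ?thesis
      using snoc.IH[of c] snoc.prems False unfolding step grid_point_def by auto
  next
    case True
    have kd: "?k d = k d"
      using snoc by auto
    define r where "r = h * f d (grid_point \<eta> ?k)"
    have "\<eta> * real_of_int \<lfloor>r / \<eta>\<rfloor> \<le> \<eta> * (r / \<eta>)" "\<eta> * (r / \<eta>) \<le> \<eta> * (real_of_int \<lfloor>r / \<eta>\<rfloor> + 1)"
      using assms(2) by (intro mult_left_mono; linarith)+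
    then have fl: "\<bar>\<eta> * real_of_int \<lfloor>r / \<eta>\<rfloor> - r\<bar> \<le> \<eta>"
      using assms(2) by (auto simp: abs_le_iff algebra_simps)
    have diff: "grid_point \<eta> (shear \<eta> h d ?k) d - grid_point \<eta> k d = \<eta> * real_of_int \<lfloor>r / \<eta>\<rfloor>"
      by (simp add: shear_def grid_point_def kd r_def algebra_simps)
    have "\<bar>f d (grid_point \<eta> ?k) - f d (grid_point \<eta> k)\<bar> \<le> L * D"
      using snoc by (intro lipschitz) auto
    then have "\<bar>h * (f d (grid_point \<eta> ?k) - f d (grid_point \<eta> k))\<bar> \<le> h * (L * D)"
      using assms(3) by (simp add: abs_mult mult_left_mono)
    then have close: "\<bar>r - h * f d (grid_point \<eta> k)\<bar> \<le> h * L * D"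
      by (simp add: r_def algebra_simps)
    have "\<bar>r\<bar> \<le> M * h"
      using bound[of d "grid_point \<eta> ?k"] assms(3)
      by (simp add: r_def abs_mult mult.commute[of M] mult_left_mono)
    then show ?thesis
      unfolding step True using fl diff close by (simp add: D_def, intro conjI; linarith)
  qed
qed

text \<open>The mean value theorem is used twice: the solution drifts by at most
  \<open>M * h\<close> during the step, so the velocity at an intermediate time differs from the
  initial one by at most \<open>L * (M * h)\<close>.\<close>

lemma solution_step_error:
  assumes Y: "\<And>t c. t \<ge> 0 \<Longrightarrow> ((\<lambda>t. Y t c) has_real_derivative f c (Y t)) (at t)"
    and "a \<ge> 0" "h > 0"
  shows "\<bar>Y (a + h) c - Y a c - h * f c (Y a)\<bar> \<le> h * L * (M * h)"
proof -
  have near: "\<bar>Y b d - Y a d\<bar> \<le> M * h" if b: "a < b" "b < a + h" for b d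
  proof -
    obtain z where z: "z > a" "z < b" "Y b d - Y a d = (b - a) * f d (Y z)"
      using MVT2[OF b(1), of "\<lambda>t. Y t d" "\<lambda>t. f d (Y t)"] Y assms by force
    have "\<bar>(b - a) * f d (Y z)\<bar> \<le> h * M"
      unfolding abs_mult using bound b by (intro mult_mono) auto
    then show ?thesis
      using z by (simp add: mult.commute)
  qed
  obtain z where z: "z > a" "z < a + h" "Y (a + h) c - Y a c = (a + h - a) * f c (Y z)"
    using MVT2[of a "a + h" "\<lambda>t. Y t c" "\<lambda>t. f c (Y t)"] Y assms by force
  have "\<bar>f c (Y z) - f c (Y a)\<bar> \<le> L * (M * h)"
    using near z by (intro lipschitz) auto
  then have "\<bar>h * (f c (Y z) - f c (Y a))\<bar> \<le> h * (L * (M * h))"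
    using assms(3) by (simp add: abs_mult mult_left_mono)
  then show ?thesis
    using z by (simp add: algebra_simps)
qed

text \<open>
  An exact discretisation of Liouville's theorem: no component of the field depends on its own
  coordinate, so the coordinates can be updated one after the other, and each rounded update is
  undone by subtracting the same integer again.
\<close>

theorem grid_bijection_approximates_flow:
  assumes "T > 0" "e > 0"
  shows "\<exists>(\<eta> :: real) (\<Psi> :: ('c \<Rightarrow> int) \<Rightarrow> 'c \<Rightarrow> int). 0 < \<eta> \<and> \<eta> \<le> e \<and> inj \<Psi> \<and>
    (\<forall>c. (\<forall>y. f c y = 0) \<longrightarrow> (\<forall>k. \<Psi> k c = k c)) \<and>
    (\<forall>Y k. (\<forall>t\<ge>0. \<forall>c. ((\<lambda>t. Y t c) has_real_derivative f c (Y t)) (at t)) \<and> Y 0 = grid_point \<eta> k \<longrightarrow>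
      (\<forall>c. \<bar>Y T c - grid_point \<eta> (\<Psi> k) c\<bar> \<le> e))"
proof -
  obtain cs :: "'c list" where cs: "distinct cs" "set cs = UNIV"
    using finite_distinct_list[OF finite] by blast
  \<comment> \<open>\<open>C * h\<^sup>2\<close> will bound the local error of one step, flow and
    grid together, for \<open>h \<le> 1\<close>.\<close>
  define C where "C = 2 * L * M + L + 1"
  have "C > 0"
    using L_pos M_nonneg by (simp add: C_def add_nonneg_pos)
  \<comment> \<open>The three summands make the step size \<open>T / m\<close> at most 1, at most
    \<open>e\<close>, and small enough for the accumulated error to stay below
    \<open>e\<close>.\<close>
  obtain m :: nat where m: "real m > T + T / e + T * C * exp (L * T) / (L * e)"
    using reals_Archimedean2 by blast
  have pos: "T / e > 0" "T * C * exp (L * T) / (L * e) > 0"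
    using assms L_pos \<open>C > 0\<close> by auto
  then have m_gt: "real m > T" "real m > T / e" "real m > T * C * exp (L * T) / (L * e)"
    using m assms by linarith+
  then have "m > 0"
    using assms by (cases m) auto
  define h where "h = T / real m"
  \<comment> \<open>With a quadratic mesh, the rounding errors of all \<open>T / h\<close> steps
    still add up to order \<open>h\<close>.\<close>
  define \<eta> where "\<eta> = h\<^sup>2"
  define \<Phi> where "\<Phi> = fold (shear \<eta> h) cs"
  have h: "0 < h" "h \<le> 1" "h \<le> e" "h * C * exp (L * T) / L \<le> e" "h * real m = T"
    using m_gt assms L_pos \<open>m > 0\<close> by (auto simp: h_def field_simps)
  have \<eta>: "\<eta> > 0" "\<eta> \<le> h"
    using h by (auto simp: \<eta>_def power2_eq_square mult_left_le)
  \<comment> \<open>Discrete Gronwall estimate: the bound solves the recursion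
    \<open>E' = (1 + L * h) * E + C * h\<^sup>2\<close> with initial value 0.\<close>
  have main: "\<bar>Y (real j * h) c - grid_point \<eta> ((\<Phi> ^^ j) k) c\<bar> \<le> h * C * ((1 + L * h) ^ j - 1) / L"
    if Y: "\<And>t c. t \<ge> 0 \<Longrightarrow> ((\<lambda>t. Y t c) has_real_derivative f c (Y t)) (at t)"
      and Y0: "Y 0 = grid_point \<eta> k" for Y k j c
  proof (induction j arbitrary: c)
    case 0
    then show ?case by (simp add: Y0)
  next
    case (Suc j)
    define E where "E = h * C * ((1 + L * h) ^ j - 1) / L"
    let ?t = "real j * h" and ?k = "(\<Phi> ^^ j) k"
    have flow: "\<bar>Y (?t + h) c - Y ?t c - h * f c (Y ?t)\<bar> \<le> h * L * (M * h)"
      using Y h by (intro solution_step_error) auto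
    have grid: "\<bar>grid_point \<eta> (\<Phi> ?k) c - grid_point \<eta> ?k c - h * f c (grid_point \<eta> ?k)\<bar>
        \<le> h * L * (M * h + \<eta>) + \<eta>"
      using fold_shear_error[OF cs(1) \<eta>(1), of h c ?k] h cs(2) by (simp add: \<Phi>_def)
    have "\<bar>f c (Y ?t) - f c (grid_point \<eta> ?k)\<bar> \<le> L * E"
      using Suc.IH by (intro lipschitz) (simp add: E_def)
    then have "\<bar>h * (f c (Y ?t) - f c (grid_point \<eta> ?k))\<bar> \<le> h * (L * E)"
      using h by (simp add: abs_mult mult_left_mono)
    then have field: "\<bar>h * f c (Y ?t) - h * f c (grid_point \<eta> ?k)\<bar> \<le> h * (L * E)"
      by (simp add: algebra_simps)
    have "\<bar>Y ?t c - grid_point \<eta> ?k c\<bar> \<le> E"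
      using Suc.IH by (simp add: E_def)
    then have "\<bar>Y (?t + h) c - grid_point \<eta> (\<Phi> ?k) c\<bar>
        \<le> E + h * L * (M * h) + (h * L * (M * h + \<eta>) + \<eta>) + h * (L * E)"
      using flow grid field by linarith
    also have "\<dots> = (1 + L * h) * E + h\<^sup>2 * (2 * L * M + L * h + 1)"
      by (simp add: \<eta>_def power2_eq_square algebra_simps)
    also have "\<dots> \<le> (1 + L * h) * E + h\<^sup>2 * C"
      using h L_pos by (auto simp: C_def intro!: mult_left_mono)
    also have "\<dots> = h * C * ((1 + L * h) ^ Suc j - 1) / L"
      using L_pos by (simp add: E_def field_simps power2_eq_square)
    finally show ?case
      by (simp add: algebra_simps)
  qed
  have "(1 + L * h) ^ m \<le> exp (L * h) ^ m"
    using h L_pos by (intro power_mono) (auto simp: add.commute)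
  also have "\<dots> = exp (L * T)"
    using h(5) by (simp flip: exp_of_nat_mult add: algebra_simps)
  finally have "h * C * ((1 + L * h) ^ m - 1) / L \<le> h * C * exp (L * T) / L"
    using h L_pos \<open>C > 0\<close> by (intro divide_right_mono mult_left_mono) auto
  then have total: "h * C * ((1 + L * h) ^ m - 1) / L \<le> e"
    using h by linarith
  show ?thesis
  proof (intro exI conjI allI impI)
    show "0 < \<eta>" "\<eta> \<le> e"
      using \<eta> h by auto
    show "inj (\<Phi> ^^ m)"
      by (intro inj_fn) (simp add: \<Phi>_def inj_fold_shear)
    show "(\<Phi> ^^ m) k c = k c" if "\<forall>y. f c y = 0" for c k
      using that by (induction m) (simp_all add: \<Phi>_def fold_shear_fixed)
    show "\<bar>Y T c - grid_point \<eta> ((\<Phi> ^^ m) k) c\<bar> \<le> e"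
      if "(\<forall>t\<ge>0. \<forall>c. ((\<lambda>t. Y t c) has_real_derivative f c (Y t)) (at t)) \<and> Y 0 = grid_point \<eta> k"
      for Y k c
      using main[of Y k m c] that total h(5) by (simp add: mult.commute)
  qed
qed

end


section \<open>Expected payoffs\<close>

lemma strategy_space_coord_nonneg: "x \<in> strategy_space S \<Longrightarrow> 0 \<le> x $ p $ s"
  by (simp add: strategy_space_def)

lemma strategy_space_coord_le_1:
  assumes "x \<in> strategy_space S"
  shows "x $ p $ s \<le> 1"
proof (cases "s \<in> S p")
  case True
  have "x $ p $ s \<le> (\<Sum>s\<in>S p. x $ p $ s)"
    using assms True by (intro member_le_sum) (auto simp: strategy_space_def)
  then show ?thesis
    using assms by (simp add: strategy_space_def)
qed (use assms in \<open>auto simp: strategy_space_def\<close>)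

lemma expected_pure_eq:
  "expected_pure S u p s x = (\<Sum>q\<in>profiles S. (\<Prod>i\<in>UNIV. play_pure x p s $ i $ q i) * u q $ p)"
  by (simp add: expected_pure_def expected_utility_def)

text \<open>Playing \<open>s\<close> overwrites the mixed strategy of \<open>p\<close>. This is the
  source of \<open>own_indep\<close> for the replicator field.\<close>

lemma expected_pure_own_indep:
  assumes "\<And>i. i \<noteq> p \<Longrightarrow> x $ i = y $ i"
  shows "expected_pure S u p s x = expected_pure S u p s y"
proof -
  have "play_pure x p s = play_pure y p s"
    using assms by (simp add: play_pure_def vec_eq_iff)
  then show ?thesis
    by (simp add: expected_pure_def)
qed

section \<open>Bounds and Lipschitz constants for payoffs\<close>

definition payoff_bound :: "('n::finite \<Rightarrow> 's::finite set) \<Rightarrow> (('n \<Rightarrow> 's) \<Rightarrow> real^'n) \<Rightarrow> real" where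
  "payoff_bound S u = (\<Sum>q\<in>profiles S. \<Sum>i\<in>UNIV. \<bar>u q $ i\<bar>)"

lemma payoff_bound_nonneg: "payoff_bound S u \<ge> 0"
  by (auto simp: payoff_bound_def intro!: sum_nonneg)

lemma sum_payoff_le_payoff_bound: "(\<Sum>q\<in>profiles S. \<bar>u q $ p\<bar>) \<le> payoff_bound S u"
  unfolding payoff_bound_def by (intro sum_mono member_le_sum) auto

lemma play_pure_coord:
  assumes "\<And>i s. 0 \<le> x $ i $ s" "\<And>i s. x $ i $ s \<le> 1"
  shows "0 \<le> play_pure x p s $ i $ t" "play_pure x p s $ i $ t \<le> 1"
  using assms by (auto simp: play_pure_def axis_def)

lemma expected_pure_bound:
  assumes "\<And>i s. 0 \<le> x $ i $ s" "\<And>i s. x $ i $ s \<le> 1"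
  shows "\<bar>expected_pure S u p s x\<bar> \<le> payoff_bound S u"
proof -
  have "\<bar>(\<Prod>i\<in>UNIV. play_pure x p s $ i $ q i) * u q $ p\<bar> \<le> \<bar>u q $ p\<bar>" for q
    using play_pure_coord[OF assms]
    by (simp add: abs_mult abs_prod prod_le_1 mult_left_le_one_le prod_nonneg)
  then have "\<bar>expected_pure S u p s x\<bar> \<le> (\<Sum>q\<in>profiles S. \<bar>u q $ p\<bar>)"
    unfolding expected_pure_eq by (intro order.trans[OF sum_abs] sum_mono)
  then show ?thesis
    using sum_payoff_le_payoff_bound by (rule order.trans)
qed

text \<open>Payoffs are multilinear, and a product of numbers in the unit interval changes by at
  most the sum of the changes of its factors.\<close>

lemma expected_pure_lipschitz:
  fixes x y :: "real^'s::finite^'n::finite"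
  assumes x: "\<And>i s. 0 \<le> x $ i $ s" "\<And>i s. x $ i $ s \<le> 1"
    and y: "\<And>i s. 0 \<le> y $ i $ s" "\<And>i s. y $ i $ s \<le> 1"
    and close: "\<And>i s. \<bar>x $ i $ s - y $ i $ s\<bar> \<le> e"
  shows "\<bar>expected_pure S u p s x - expected_pure S u p s y\<bar> \<le> real CARD('n) * e * payoff_bound S u"
proof -
  have "e \<ge> 0"
    using close[of undefined undefined] by linarith
  have "\<bar>(\<Prod>i\<in>UNIV. play_pure x p s $ i $ q i) - (\<Prod>i\<in>UNIV. play_pure y p s $ i $ q i)\<bar>
      \<le> real CARD('n) * e" for q
  proof -
    have "norm ((\<Prod>i\<in>UNIV. play_pure x p s $ i $ q i) - (\<Prod>i\<in>UNIV. play_pure y p s $ i $ q i))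
        \<le> (\<Sum>i\<in>UNIV. norm (play_pure x p s $ i $ q i - play_pure y p s $ i $ q i))"
      using play_pure_coord[OF x] play_pure_coord[OF y] by (intro norm_prod_diff) auto
    also have "\<dots> \<le> (\<Sum>i\<in>(UNIV::'n set). e)"
      using close \<open>e \<ge> 0\<close> by (intro sum_mono) (auto simp: play_pure_def)
    finally show ?thesis by simp
  qed
  then have "\<bar>((\<Prod>i\<in>UNIV. play_pure x p s $ i $ q i) - (\<Prod>i\<in>UNIV. play_pure y p s $ i $ q i)) * u q $ p\<bar>
      \<le> real CARD('n) * e * \<bar>u q $ p\<bar>" for q
    unfolding abs_mult by (intro mult_right_mono) auto
  then have "\<bar>expected_pure S u p s x - expected_pure S u p s y\<bar>
      \<le> (\<Sum>q\<in>profiles S. real CARD('n) * e * \<bar>u q $ p\<bar>)"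
    unfolding expected_pure_eq sum_subtractf[symmetric] left_diff_distrib[symmetric]
    by (intro order.trans[OF sum_abs] sum_mono)
  also have "\<dots> \<le> real CARD('n) * e * payoff_bound S u"
    using sum_payoff_le_payoff_bound[where S=S and u=u and p=p] \<open>e \<ge> 0\<close>
    by (auto simp flip: sum_distrib_left intro!: mult_left_mono)
  finally show ?thesis .
qed

lemma dist_le_coords:
  fixes x y :: "real^'s::finite^'n::finite"
  assumes "\<And>p s. \<bar>x $ p $ s - y $ p $ s\<bar> \<le> e"
  shows "dist x y \<le> real CARD('n) * real CARD('s) * e"
proof -
  have "norm (x $ p - y $ p) \<le> real CARD('s) * e" for p
  proof -
    have "norm (x $ p - y $ p) \<le> (\<Sum>s\<in>UNIV. \<bar>(x $ p - y $ p) $ s\<bar>)"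
      by (rule norm_le_l1_cart)
    also have "\<dots> \<le> (\<Sum>s\<in>(UNIV::'s set). e)"
      using assms by (intro sum_mono) simp
    finally show ?thesis by simp
  qed
  then have "(\<Sum>p\<in>UNIV. norm ((x - y) $ p)) \<le> (\<Sum>p\<in>(UNIV::'n set). real CARD('s) * e)"
    by (intro sum_mono) simp
  moreover have "dist x y \<le> (\<Sum>p\<in>UNIV. norm ((x - y) $ p))"
    unfolding dist_norm norm_vec_def by (rule L2_set_le_sum) simp
  ultimately show ?thesis by simp
qed


section \<open>Logarithmic coordinates on the faces of the strategy space\<close>

definition strategy_support :: "real^'s^'n \<Rightarrow> ('n \<times> 's) set" where
  "strategy_support x = {(p, s). 0 < x $ p $ s}"

text \<open>Parametrises the open face with support \<open>B\<close>. Adding a constant to all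
  coordinates of one player leaves the value unchanged.\<close>

definition softmax :: "('n \<times> 's) set \<Rightarrow> ('n \<times> 's \<Rightarrow> real) \<Rightarrow> real^'s::finite^'n::finite" where
  "softmax B y = (\<chi> p s. if (p, s) \<in> B then exp (y (p, s)) / (\<Sum>t | (p, t) \<in> B. exp (y (p, t))) else 0)"

text \<open>Ratios to the base strategy \<open>b p\<close> remove the shift freedom of
  \<open>softmax\<close>. The default 0 off \<open>B\<close> lets one index type serve all
  faces.\<close>

definition log_coords :: "('n \<times> 's) set \<Rightarrow> ('n \<Rightarrow> 's) \<Rightarrow> real^'s^'n \<Rightarrow> 'n \<times> 's \<Rightarrow> real" where
  "log_coords B b x = (\<lambda>(p, s). if (p, s) \<in> B then ln (x $ p $ s) - ln (x $ p $ b p) else 0)"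

lemma sum_strategy_support:
  fixes x :: "real^'s::finite^'n::finite"
  assumes "x \<in> strategy_space S"
  shows "(\<Sum>s | (p, s) \<in> strategy_support x. x $ p $ s) = 1"
proof -
  have "(\<Sum>s | (p, s) \<in> strategy_support x. x $ p $ s) = (\<Sum>s\<in>S p. x $ p $ s)"
    using assms by (intro sum.mono_neutral_left)
      (auto simp: strategy_support_def strategy_space_def less_le)
  then show ?thesis
    using assms by (simp add: strategy_space_def)
qed

lemma ex_strategy_support:
  fixes x :: "real^'s::finite^'n::finite"
  assumes "x \<in> strategy_space S"
  shows "\<exists>s. (p, s) \<in> strategy_support x"
proof (rule ccontr)
  assume "\<nexists>s. (p, s) \<in> strategy_support x"
  then show False
    using sum_strategy_support[OF assms, of p] by simp
qed

lemma strategy_support_subset: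
  "x \<in> strategy_space S \<Longrightarrow> (p, s) \<in> strategy_support x \<Longrightarrow> s \<in> S p"
  by (auto simp: strategy_space_def strategy_support_def) (metis less_irrefl)

lemma softmax_denominator_pos:
  fixes B :: "('n::finite \<times> 's::finite) set"
  shows "(p, s) \<in> B \<Longrightarrow> (\<Sum>t | (p, t) \<in> B. exp (y (p, t) :: real)) > 0"
  by (rule sum_pos2[of _ s]) auto

lemma strategy_support_softmax: "strategy_support (softmax B y) = B"
  by (auto simp: strategy_support_def softmax_def softmax_denominator_pos)

lemma softmax_coord_nonneg: "0 \<le> softmax B y $ p $ s"
  by (auto simp: softmax_def intro!: divide_nonneg_nonneg sum_nonneg)

lemma softmax_coord_le_1: "softmax B y $ p $ s \<le> 1"
proof (cases "(p, s) \<in> B")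
  case True
  have "exp (y (p, s)) \<le> (\<Sum>t | (p, t) \<in> B. exp (y (p, t)))"
    using True by (intro member_le_sum[of s _ "\<lambda>t. exp (y (p, t))"]) auto
  then show ?thesis
    using True softmax_denominator_pos[OF True, of y] by (simp add: softmax_def divide_le_eq_1)
qed (simp add: softmax_def)

lemma softmax_in_strategy_space:
  fixes B :: "('n::finite \<times> 's::finite) set"
  assumes "\<And>p s. (p, s) \<in> B \<Longrightarrow> s \<in> S p" and "\<And>p. (p, b p) \<in> B"
  shows "softmax B y \<in> strategy_space S"
proof -
  have "(\<Sum>s\<in>S p. softmax B y $ p $ s) = 1" for p
  proof -
    have "(\<Sum>s\<in>S p. softmax B y $ p $ s) = (\<Sum>s | (p, s) \<in> B. softmax B y $ p $ s)"
      using assms by (intro sum.mono_neutral_right) (auto simp: softmax_def)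
    also have "\<dots> = (\<Sum>s | (p, s) \<in> B. exp (y (p, s))) / (\<Sum>t | (p, t) \<in> B. exp (y (p, t)))"
      by (simp add: softmax_def flip: sum_divide_distrib)
    also have "\<dots> = 1"
      using softmax_denominator_pos[OF assms(2), where p = p and y = y] by simp
    finally show ?thesis .
  qed
  moreover have "softmax B y $ p $ s = 0" if "s \<notin> S p" for p s
    using assms that by (auto simp: softmax_def)
  ultimately show ?thesis
    by (simp add: strategy_space_def softmax_coord_nonneg)
qed

text \<open>Numerator and denominator each change by a factor of at most \<open>exp e\<close>, the
  quotient by at most \<open>exp (2 * e) \<le> 1 + 4 * e\<close> when
  \<open>2 * e \<le> 1/2\<close>. For larger \<open>e\<close> the bound exceeds 1, and two
  probabilities never differ by more.\<close>

lemma softmax_lipschitz: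
  fixes B :: "('n::finite \<times> 's::finite) set"
  assumes "\<And>c. \<bar>y c - z c\<bar> \<le> e"
  shows "\<bar>softmax B y $ p $ s - softmax B z $ p $ s\<bar> \<le> 4 * e"
proof -
  have "e \<ge> 0"
    using assms[of undefined] by linarith
  have one: "softmax B y $ p $ s - softmax B z $ p $ s \<le> 4 * e"
    if close: "\<And>c. \<bar>y c - z c\<bar> \<le> e" for y z :: "'n \<times> 's \<Rightarrow> real"
  proof (cases "2 * e \<le> 1/2 \<and> (p, s) \<in> B")
    case True
    let ?Y = "\<Sum>t | (p, t) \<in> B. exp (y (p, t))" and ?Z = "\<Sum>t | (p, t) \<in> B. exp (z (p, t))"
    have Y: "?Y > 0" and Z: "?Z > 0"
      using True softmax_denominator_pos by blast+
    have num: "exp (y (p, s)) \<le> exp e * exp (z (p, s))"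
      using close[of "(p, s)"] by (simp flip: exp_add)
    have "exp (z (p, t)) \<le> exp e * exp (y (p, t))" for t
      using close[of "(p, t)"] by (simp flip: exp_add)
    then have den: "?Z \<le> exp e * ?Y"
      by (simp add: sum_distrib_left sum_mono)
    have frac: "a / ?Y \<le> c * (d / ?Z)" if "a * ?Z \<le> c * (d * ?Y)" for a c d
      using that Y Z by (simp add: field_simps)
    have "exp (y (p, s)) * ?Z \<le> (exp e * exp (z (p, s))) * (exp e * ?Y)"
      using num den Z by (intro mult_mono) auto
    also have "\<dots> = (exp e * exp e) * (exp (z (p, s)) * ?Y)"
      by (simp only: mult_ac)
    also have "\<dots> = exp (2 * e) * (exp (z (p, s)) * ?Y)"
      by (simp only: mult_2 exp_add)
    finally have "exp (y (p, s)) / ?Y \<le> exp (2 * e) * (exp (z (p, s)) / ?Z)"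
      by (rule frac)
    then have "softmax B y $ p $ s \<le> exp (2 * e) * softmax B z $ p $ s"
      using True by (simp add: softmax_def)
    also have "\<dots> \<le> (1 + 2 * (2 * e)) * softmax B z $ p $ s"
      using exp_bound_lemma[of "2 * e"] True \<open>e \<ge> 0\<close>
      by (intro mult_right_mono softmax_coord_nonneg) auto
    also have "\<dots> \<le> softmax B z $ p $ s + 4 * e"
      using softmax_coord_le_1[of B z p s] \<open>e \<ge> 0\<close>
      by (simp add: distrib_right mult_left_le)
    finally show ?thesis by simp
  next
    case False
    show ?thesis
      using False softmax_coord_le_1[of B y p s] softmax_coord_nonneg[of B z p s] \<open>e \<ge> 0\<close>
      by (cases "(p, s) \<in> B") (auto simp: softmax_def)
  qed
  show ?thesis
    using one[of y z] one[of z y] assms by (auto simp: abs_le_iff abs_minus_commute)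
qed

lemma softmax_log_coords:
  fixes x :: "real^'s::finite^'n::finite"
  assumes "x \<in> strategy_space S" and "\<And>p. (p, b p) \<in> strategy_support x"
  shows "softmax (strategy_support x) (log_coords (strategy_support x) b x) = x"
proof -
  let ?B = "strategy_support x"
  have e: "exp (log_coords ?B b x (p, s)) = x $ p $ s / x $ p $ b p" if "(p, s) \<in> ?B" for p s
    using that assms(2)[of p] by (simp add: log_coords_def strategy_support_def exp_diff)
  have "(\<Sum>t | (p, t) \<in> ?B. exp (log_coords ?B b x (p, t))) = 1 / x $ p $ b p" for p
    using sum_strategy_support[OF assms(1), of p] by (simp add: e flip: sum_divide_distrib)
  then have "softmax ?B (log_coords ?B b x) $ p $ s = (if (p, s) \<in> ?B then x $ p $ s else 0)" for p s
    using assms(2)[of p] by (auto simp: softmax_def e) (auto simp: strategy_support_def)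
  moreover have "x $ p $ s = 0" if "(p, s) \<notin> ?B" for p s
    using that strategy_space_coord_nonneg[OF assms(1), of p s] by (simp add: strategy_support_def)
  ultimately have "softmax ?B (log_coords ?B b x) $ p $ s = x $ p $ s" for p s
    by simp
  then show ?thesis
    by (simp add: vec_eq_iff)
qed

lemma log_coords_softmax:
  fixes B :: "('n::finite \<times> 's::finite) set"
  assumes "\<And>c. c \<notin> B \<Longrightarrow> y c = 0" "\<And>p. y (p, b p) = 0" "\<And>p. (p, b p) \<in> B"
  shows "log_coords B b (softmax B y) = y"
proof
  fix c
  show "log_coords B b (softmax B y) c = y c"
    using assms softmax_denominator_pos[of "fst c" "snd c" B y] softmax_denominator_pos[of "fst c" "b (fst c)" B y]
    by (cases c) (auto simp: log_coords_def softmax_def ln_div)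
qed

text \<open>Distance from the boundary of the face confines the logarithmic coordinates to a cube,
  which contains finitely many grid points.\<close>

lemma log_coords_bound:
  assumes "x \<in> strategy_space S" "\<delta> > 0" "\<And>p s. (p, s) \<in> B \<Longrightarrow> \<delta> \<le> x $ p $ s"
    and "\<And>p. (p, b p) \<in> B"
  shows "\<bar>log_coords B b x c\<bar> \<le> \<bar>2 * ln \<delta>\<bar>"
proof (cases c)
  case (Pair p s)
  have "ln \<delta> \<le> ln (x $ p $ s) \<and> ln (x $ p $ s) \<le> 0" if "(p, s) \<in> B" for s
    using assms(2) assms(3)[OF that] strategy_space_coord_le_1[OF assms(1), of p s] by simp
  from this[of s] this[OF assms(4)]
  have "\<bar>ln (x $ p $ s) - ln (x $ p $ b p)\<bar> \<le> \<bar>2 * ln \<delta>\<bar>" if "(p, s) \<in> B"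
    using that by linarith
  then show ?thesis
    by (simp add: Pair log_coords_def)
qed

text \<open>Giving the whole weight of \<open>s\<close> to \<open>a\<close> removes
  \<open>(p, s)\<close> from the support, so a point with a small coordinate lies close to a smaller
  face.\<close>

lemma move_mass:
  fixes x :: "real^'s::finite^'n::finite"
  assumes x: "x \<in> strategy_space S" and "s \<noteq> a"
    and s: "(p, s) \<in> strategy_support x" and a: "(p, a) \<in> strategy_support x"
  obtains w where "w \<in> strategy_space S" "strategy_support w \<subset> strategy_support x"
    "dist x w \<le> 2 * x $ p $ s"
proof
  define w where "w = x + axis p (x $ p $ s *\<^sub>R (axis a 1 - axis s 1))"
  have w: "w $ q $ t = x $ q $ t + (if q = p then x $ p $ s * ((if t = a then 1 else 0) - (if t = s then 1 else 0)) else 0)"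
    for q t
    by (simp add: w_def axis_def)
  have inS: "s \<in> S p" "a \<in> S p"
    using strategy_support_subset[OF x] s a by auto
  have "(\<Sum>t\<in>S q. w $ q $ t) = 1" for q
  proof (cases "q = p")
    case True
    have "(\<Sum>t\<in>S p. w $ p $ t) = (\<Sum>t\<in>S p. x $ p $ t)"
      using inS by (simp add: w sum.distrib sum_subtractf right_diff_distrib if_distrib[of "\<lambda>z. x $ p $ s * z"] cong: if_cong)
    then show ?thesis
      using x True by (simp add: strategy_space_def)
  qed (use x in \<open>simp add: w strategy_space_def\<close>)
  then show "w \<in> strategy_space S"
    using x inS \<open>s \<noteq> a\<close> by (auto simp: strategy_space_def w)
  have "(p, s) \<notin> strategy_support w"
    using \<open>s \<noteq> a\<close> by (simp add: strategy_support_def w)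
  moreover have "strategy_support w \<subseteq> strategy_support x"
    using s a by (auto simp: strategy_support_def w split: if_splits)
  ultimately show "strategy_support w \<subset> strategy_support x"
    using s by blast
  have "norm (axis a 1 - axis s 1 :: real^'s) \<le> 2"
    using norm_triangle_ineq4[of "axis a 1 :: real^'s" "axis s 1"] by simp
  then have "\<bar>x $ p $ s\<bar> * norm (axis a 1 - axis s 1 :: real^'s) \<le> x $ p $ s * 2"
    using s by (auto simp: strategy_support_def intro!: mult_mono)
  moreover have "norm (axis p v :: real^'s^'n) = norm v" for v :: "real^'s"
  proof -
    have "norm (axis p v :: real^'s^'n) = sqrt (\<Sum>i\<in>UNIV. if i = p then (norm v)\<^sup>2 else 0)"
      unfolding norm_vec_def L2_set_def by (intro arg_cong[of _ _ sqrt] sum.cong) (auto simp: axis_def)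
    then show ?thesis by simp
  qed
  ultimately show "dist x w \<le> 2 * x $ p $ s"
    by (simp add: w_def dist_norm)
qed


section \<open>The replicator flow reaches a pure profile\<close>

locale replicator_system =
  fixes S :: "'n::finite \<Rightarrow> 's::finite set"
    and u :: "('n \<Rightarrow> 's) \<Rightarrow> real^'n"
    and \<phi> :: "real^'s^'n \<Rightarrow> real \<Rightarrow> real^'s^'n"
  assumes flow: "replicator_flow S u \<phi>"
begin

section \<open>Growth rates and invariance of the open faces\<close>

lemma flow_in_strategy_space: "x \<in> strategy_space S \<Longrightarrow> \<phi> x t \<in> strategy_space S"
  using flow by (simp add: replicator_flow_def flow_on_def)

lemma flow_0: "x \<in> strategy_space S \<Longrightarrow> \<phi> x 0 = x"
  using flow by (simp add: replicator_flow_def flow_on_def)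

definition growth :: "'n \<Rightarrow> 's \<Rightarrow> real^'s^'n \<Rightarrow> real" where
  "growth p s x = expected_pure S u p s x - (\<Sum>t\<in>S p. x $ p $ t * expected_pure S u p t x)"

lemma flow_coord_has_derivative:
  assumes "x \<in> strategy_space S"
  shows "((\<lambda>t. \<phi> x t $ p $ s) has_real_derivative \<phi> x t $ p $ s * growth p s (\<phi> x t)) (at t)"
proof -
  have "(\<phi> x has_vector_derivative replicator_field S u (\<phi> x t)) (at t)"
    using flow assms by (simp add: replicator_flow_def)
  then have "((\<lambda>t. \<phi> x t $ p $ s) has_vector_derivative replicator_field S u (\<phi> x t) $ p $ s) (at t)"
    by (intro bounded_linear.has_vector_derivative[OF bounded_linear_vec_nth])
  then show ?thesis
    by (simp add: has_real_derivative_iff_has_vector_derivative replicator_field_def growth_def)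
qed

lemma expected_pure_bound':
  "x \<in> strategy_space S \<Longrightarrow> \<bar>expected_pure S u p s x\<bar> \<le> payoff_bound S u"
  by (rule expected_pure_bound) (auto simp: strategy_space_coord_nonneg strategy_space_coord_le_1)

lemma growth_bound:
  assumes "x \<in> strategy_space S"
  shows "\<bar>growth p s x\<bar> \<le> 2 * payoff_bound S u"
proof -
  have "\<bar>\<Sum>t\<in>S p. x $ p $ t * expected_pure S u p t x\<bar> \<le> (\<Sum>t\<in>S p. x $ p $ t * payoff_bound S u)"
    using assms expected_pure_bound'[OF assms] strategy_space_coord_nonneg[OF assms]
    by (intro order.trans[OF sum_abs] sum_mono) (simp add: abs_mult mult_left_mono)
  also have "\<dots> = payoff_bound S u"
    using assms by (simp add: strategy_space_def flip: sum_distrib_right)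
  finally show ?thesis
    using expected_pure_bound'[OF assms, of p s] unfolding growth_def by linarith
qed

text \<open>Since growth rates lie between \<open>- K\<close> and \<open>K\<close>, a coordinate
  times \<open>exp (K * t)\<close> never decreases and times \<open>exp (- K * t)\<close> never
  increases.\<close>

lemma flow_coord_bounds:
  assumes x: "x \<in> strategy_space S" and "t \<ge> 0"
  defines "K \<equiv> 2 * payoff_bound S u"
  shows "x $ p $ s * exp (- K * t) \<le> \<phi> x t $ p $ s" "\<phi> x t $ p $ s \<le> x $ p $ s * exp (K * t)"
proof -
  have deriv: "((\<lambda>t. \<phi> x t $ p $ s * exp (a * t)) has_real_derivative
      \<phi> x t $ p $ s * exp (a * t) * (growth p s (\<phi> x t) + a)) (at t)" for a t
    by (auto intro!: derivative_eq_intros flow_coord_has_derivative[OF x] simp: algebra_simps)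
  have pos: "\<phi> x t $ p $ s * exp (a * t) \<ge> 0" for a t
    using strategy_space_coord_nonneg[OF flow_in_strategy_space[OF x]] by simp
  have growth: "\<bar>growth p s (\<phi> x t)\<bar> \<le> K" for t
    using growth_bound[OF flow_in_strategy_space[OF x]] by (simp add: K_def)
  have "\<phi> x 0 $ p $ s * exp (K * 0) \<le> \<phi> x t $ p $ s * exp (K * t)"
  proof (rule DERIV_nonneg_imp_nondecreasing[OF assms(2)])
    fix \<tau>
    have "growth p s (\<phi> x \<tau>) + K \<ge> 0"
      using growth[of \<tau>] by linarith
    then show "\<exists>y. ((\<lambda>t. \<phi> x t $ p $ s * exp (K * t)) has_real_derivative y) (at \<tau>) \<and> 0 \<le> y"
      by - (rule exI, rule conjI[OF deriv], intro mult_nonneg_nonneg pos)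
  qed
  then show "x $ p $ s * exp (- K * t) \<le> \<phi> x t $ p $ s"
    using flow_0[OF x] by (simp add: exp_minus field_simps)
  have "\<phi> x t $ p $ s * exp (- K * t) \<le> \<phi> x 0 $ p $ s * exp (- K * 0)"
  proof (rule DERIV_nonpos_imp_nonincreasing[OF assms(2)])
    fix \<tau>
    have "growth p s (\<phi> x \<tau>) + - K \<le> 0"
      using growth[of \<tau>] by linarith
    then show "\<exists>y. ((\<lambda>t. \<phi> x t $ p $ s * exp (- K * t)) has_real_derivative y) (at \<tau>) \<and> y \<le> 0"
      by - (rule exI, rule conjI[OF deriv], intro mult_nonneg_nonpos pos)
  qed
  then show "\<phi> x t $ p $ s \<le> x $ p $ s * exp (K * t)"
    using flow_0[OF x] by (simp add: exp_minus field_simps)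
qed

lemma strategy_support_flow:
  assumes "x \<in> strategy_space S" "t \<ge> 0"
  shows "strategy_support (\<phi> x t) = strategy_support x"
proof -
  have "0 < \<phi> x t $ p $ s \<longleftrightarrow> 0 < x $ p $ s" for p s
    using flow_coord_bounds[OF assms, of p s]
    by (smt (verit) exp_gt_zero mult_pos_pos mult_nonpos_nonneg)
  then show ?thesis
    by (simp add: strategy_support_def)
qed

section \<open>The replicator equation in logarithmic coordinates\<close>

definition log_field :: "('n \<times> 's) set \<Rightarrow> ('n \<Rightarrow> 's) \<Rightarrow> 'n \<times> 's \<Rightarrow> ('n \<times> 's \<Rightarrow> real) \<Rightarrow> real" where
  "log_field B b = (\<lambda>(p, s) y. if (p, s) \<in> B
     then expected_pure S u p s (softmax B y) - expected_pure S u p (b p) (softmax B y) else 0)"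

text \<open>The factor 8 combines a difference of two payoffs with the Lipschitz constant 4 of
  \<open>softmax\<close>; the summand 1 keeps the constant positive when all payoffs vanish.\<close>

lemma shear_field_log_field:
  "shear_field (log_field B b) (2 * payoff_bound S u) (8 * real CARD('n) * payoff_bound S u + 1)"
proof
  fix c :: "'n \<times> 's" and y z :: "'n \<times> 's \<Rightarrow> real" and e v :: real
  obtain p s where c: "c = (p, s)"
    by (cases c)
  have "\<bar>expected_pure S u p s (softmax B y)\<bar> \<le> payoff_bound S u" for s
    by (intro expected_pure_bound softmax_coord_nonneg softmax_coord_le_1)
  from this[of s] this[of "b p"]
  have "\<bar>expected_pure S u p s (softmax B y) - expected_pure S u p (b p) (softmax B y)\<bar>
      \<le> 2 * payoff_bound S u"
    by linarith
  then show "\<bar>log_field B b c y\<bar> \<le> 2 * payoff_bound S u"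
    using payoff_bound_nonneg[of S u] by (simp add: c log_field_def)
  show "\<bar>log_field B b c y - log_field B b c z\<bar> \<le> (8 * real CARD('n) * payoff_bound S u + 1) * e"
    if close: "\<And>d. \<bar>y d - z d\<bar> \<le> e"
  proof -
    have "e \<ge> 0"
      using close[of undefined] by linarith
    have "\<bar>expected_pure S u p s (softmax B y) - expected_pure S u p s (softmax B z)\<bar>
        \<le> real CARD('n) * (4 * e) * payoff_bound S u" for s
      by (intro expected_pure_lipschitz softmax_coord_nonneg softmax_coord_le_1 softmax_lipschitz close)
    from this[of s] this[of "b p"]
    have "\<bar>(expected_pure S u p s (softmax B y) - expected_pure S u p (b p) (softmax B y)) -
        (expected_pure S u p s (softmax B z) - expected_pure S u p (b p) (softmax B z))\<bar>
        \<le> 2 * (real CARD('n) * (4 * e) * payoff_bound S u)"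
      by linarith
    then have "\<bar>log_field B b c y - log_field B b c z\<bar> \<le> 2 * (real CARD('n) * (4 * e) * payoff_bound S u)"
      using payoff_bound_nonneg[of S u] \<open>e \<ge> 0\<close> by (auto simp: c log_field_def)
    also have "\<dots> \<le> (8 * real CARD('n) * payoff_bound S u + 1) * e"
      using \<open>e \<ge> 0\<close> by (simp add: algebra_simps)
    finally show ?thesis .
  qed
  \<comment> \<open>Changing the coordinate \<open>(p, s)\<close> affects only the mixed strategy of
    \<open>p\<close>, which the pure payoffs of \<open>p\<close> ignore.\<close>
  have "expected_pure S u p s (softmax B (y(c := v))) = expected_pure S u p s (softmax B y)" for s
    by (intro expected_pure_own_indep) (simp add: softmax_def c vec_eq_iff)
  then show "log_field B b c (y(c := v)) = log_field B b c y"
    by (simp add: c log_field_def)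
next
  show "8 * real CARD('n) * payoff_bound S u + 1 > 0"
    using payoff_bound_nonneg[of S u] by (simp add: add_nonneg_pos)
qed

text \<open>The logarithm of a positive coordinate has derivative \<open>growth\<close>; subtracting
  the base strategy cancels the average payoff, which both share.\<close>

lemma log_coords_flow_has_derivative:
  assumes x: "x \<in> strategy_space S" and "t \<ge> 0"
    and b: "\<And>p. (p, b p) \<in> strategy_support x"
  defines "B \<equiv> strategy_support x"
  shows "((\<lambda>t. log_coords B b (\<phi> x t) c) has_real_derivative
    log_field B b c (log_coords B b (\<phi> x t))) (at t)"
proof (cases c)
  case (Pair p s)
  have supp: "strategy_support (\<phi> x t) = B"
    using strategy_support_flow[OF x \<open>t \<ge> 0\<close>] by (simp only: B_def)
  have bB: "(p, b p) \<in> B" for p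
    using b by (simp only: B_def)
  have inv: "softmax B (log_coords B b (\<phi> x t)) = \<phi> x t"
    using softmax_log_coords[OF flow_in_strategy_space[OF x], of b t] bB unfolding supp by blast
  have ln: "((\<lambda>t. ln (\<phi> x t $ p $ s)) has_real_derivative growth p s (\<phi> x t)) (at t)"
    if "(p, s) \<in> B" for s
  proof -
    have pos: "\<phi> x t $ p $ s > 0"
      using that unfolding supp[symmetric] by (simp add: strategy_support_def)
    show ?thesis
      using DERIV_chain2[OF DERIV_ln_divide[OF pos] flow_coord_has_derivative[OF x]] pos by simp
  qed
  show ?thesis
  proof (cases "(p, s) \<in> B")
    case True
    have "growth p s (\<phi> x t) - growth p (b p) (\<phi> x t) = log_field B b (p, s) (log_coords B b (\<phi> x t))"
      unfolding log_field_def prod.case inv using True by (simp add: growth_def)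
    then show ?thesis
      using DERIV_diff[OF ln[OF True] ln[OF bB]] True by (simp add: Pair log_coords_def)
  next
    case False
    then show ?thesis
      by (simp add: Pair log_coords_def log_field_def)
  qed
qed

text \<open>
  If no smaller support were reachable, the grid points reachable inside the face would form a
  bounded, hence finite set. The grid bijection \<open>\<Psi>\<close> approximating \<open>\<phi>\<close> at time \<open>T\<close> maps this set
  into itself, hence onto itself; but the tolerance \<open>\<epsilon>\<close> also allows a further step of one grid unit
  after \<open>\<Psi>\<close>, so the set would be closed under adding a unit vector.
\<close>

lemma reaches_smaller_support:
  assumes x: "x \<in> strategy_space S" and "\<epsilon> > 0" "T > 0"
    and mixed: "(p0, s0) \<in> strategy_support x" "(p0, a0) \<in> strategy_support x" "s0 \<noteq> a0"
  shows "\<exists>z. (chain_step (strategy_space S) \<phi> \<epsilon> T)\<^sup>*\<^sup>* x z \<and> z \<in> strategy_space S \<and>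
    strategy_support z \<subset> strategy_support x"
proof (rule ccontr)
  assume contra: "\<not> ?thesis"
  let ?X = "strategy_space S" and ?step = "chain_step (strategy_space S) \<phi> \<epsilon> T"
  define B where "B = strategy_support x"
  \<comment> \<open>The base strategy of \<open>p0\<close> is \<open>a0\<close>, so that
    \<open>(p0, s0)\<close> remains a free coordinate.\<close>
  define b where "b = (\<lambda>p. SOME s. (p, s) \<in> B)(p0 := a0)"
  have b: "(p, b p) \<in> B" for p
    using mixed ex_strategy_support[OF x] by (auto simp: b_def B_def intro: someI_ex)
  have BS: "s \<in> S p" if "(p, s) \<in> B" for p s
    using strategy_support_subset[OF x] that by (simp add: B_def)
  define K where "K = 2 * payoff_bound S u"
  \<comment> \<open>A coordinate below \<open>\<epsilon> / 4 * exp (- K * T)\<close> is still below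
    \<open>\<epsilon> / 4\<close> at time \<open>T\<close>, and moving its mass away is a jump
    shorter than \<open>\<epsilon>\<close>. The minimum with 1 covers players with one strategy in
    the support.\<close>
  define \<delta> where "\<delta> = min 1 (\<epsilon> / 4 * exp (- K * T))"
  have \<delta>: "\<delta> > 0"
    using assms(2) by (simp add: \<delta>_def)
  have interior: "\<delta> \<le> z $ p $ s"
    if z: "?step\<^sup>*\<^sup>* x z" "z \<in> ?X" "strategy_support z = B" and ps: "(p, s) \<in> B" for z p s
  proof (cases "\<exists>a. (p, a) \<in> B \<and> s \<noteq> a")
    case False
    then have "{t. (p, t) \<in> B} = {s}"
      using ps by blast
    then show ?thesis
      using sum_strategy_support[OF z(2), of p] by (simp add: z(3) \<delta>_def)
  next
    case True
    then obtain a where a: "(p, a) \<in> B" "s \<noteq> a"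
      by blast
    have supp: "strategy_support (\<phi> z T) = B"
      using strategy_support_flow[OF z(2)] \<open>T > 0\<close> z(3) by simp
    obtain w where w: "w \<in> ?X" "strategy_support w \<subset> B" "dist (\<phi> z T) w \<le> 2 * \<phi> z T $ p $ s"
      using move_mass[OF flow_in_strategy_space[OF z(2)] a(2), of p T] a ps unfolding supp by blast
    have "\<not> ?step z w"
      using contra w z(1) by (metis B_def rtranclp.rtrancl_into_rtrancl)
    then have "\<epsilon> \<le> dist (\<phi> z T) w"
      using w z unfolding chain_step_def by (metis order_refl not_le)
    then have "\<epsilon> \<le> 2 * (z $ p $ s * exp (K * T))"
      using w(3) flow_coord_bounds(2)[OF z(2), of T p s] \<open>T > 0\<close> by (simp add: K_def)
    then have "\<epsilon> * exp (- K * T) \<le> 2 * z $ p $ s"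
      by (simp add: exp_minus field_simps)
    moreover have "\<epsilon> * exp (- K * T) > 0"
      using \<open>\<epsilon> > 0\<close> by simp
    ultimately show ?thesis
      by (simp add: \<delta>_def min_def)
  qed
  interpret shear_field "log_field B b" "2 * payoff_bound S u" "8 * real CARD('n) * payoff_bound S u + 1"
    by (rule shear_field_log_field)
  define W where "W = real CARD('n) * real CARD('s)"
  have W: "W > 0"
    by (simp add: W_def)
  \<comment> \<open>An error of \<open>2 * e\<close> in logarithmic coordinates, half for the scheme
    and half for one grid unit, becomes \<open>8 * W * e = \<epsilon> / 2\<close> in the strategy
    space.\<close>
  define e where "e = \<epsilon> / (16 * W)"
  have e: "e > 0" "W * (4 * (2 * e)) < \<epsilon>"
    using W \<open>\<epsilon> > 0\<close> by (simp_all add: e_def)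
  obtain \<eta> \<Psi> where \<eta>: "0 < \<eta>" "\<eta> \<le> e" and "inj \<Psi>"
    and \<Psi>_fixed: "\<forall>c. (\<forall>y. log_field B b c y = 0) \<longrightarrow> (\<forall>k. \<Psi> k c = k c)"
    and \<Psi>: "\<forall>Y k. (\<forall>t\<ge>0. \<forall>c. ((\<lambda>t. Y t c) has_real_derivative log_field B b c (Y t)) (at t)) \<and>
      Y 0 = grid_point \<eta> k \<longrightarrow> (\<forall>c. \<bar>Y T c - grid_point \<eta> (\<Psi> k) c\<bar> \<le> e)"
    using grid_bijection_approximates_flow[OF \<open>T > 0\<close> e(1)] by blast
  \<comment> \<open>Only these grid points are logarithmic coordinates of points of the
    face.\<close>
  define N where "N = {k :: 'n \<times> 's \<Rightarrow> int. \<forall>p s. (p, s) \<notin> B \<or> s = b p \<longrightarrow> k (p, s) = 0}"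
  have sm: "softmax B y \<in> ?X" "strategy_support (softmax B y) = B" for y
    using BS b by (auto simp: strategy_support_softmax intro!: softmax_in_strategy_space[where b = b])
  have log: "log_coords B b (softmax B (grid_point \<eta> k)) = grid_point \<eta> k" if "k \<in> N" for k
    using that b by (intro log_coords_softmax) (auto simp: N_def grid_point_def)
  have step: "?step z (softmax B (grid_point \<eta> k))"
    if z: "z \<in> ?X" "strategy_support z = B"
      and close: "\<And>c. \<bar>log_coords B b (\<phi> z T) c - grid_point \<eta> k c\<bar> \<le> 2 * e" for z k
  proof -
    have supp: "strategy_support (\<phi> z T) = B"
      using strategy_support_flow[OF z(1)] \<open>T > 0\<close> z(2) by simp
    have "softmax B (log_coords B b (\<phi> z T)) = \<phi> z T"
      using softmax_log_coords[OF flow_in_strategy_space[OF z(1)], of b T] b supp by simp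
    then have "dist (\<phi> z T) (softmax B (grid_point \<eta> k)) \<le> W * (4 * (2 * e))"
      using softmax_lipschitz[of "log_coords B b (\<phi> z T)" "grid_point \<eta> k", OF close, of B] unfolding W_def by (intro dist_le_coords) simp
    then show ?thesis
      unfolding chain_step_def using e z sm by (intro conjI exI[of _ T]) auto
  qed
  define R where "R = {k \<in> N. ?step\<^sup>*\<^sup>* x (softmax B (grid_point \<eta> k))}"
  have "R \<noteq> {}"
  proof -
    \<comment> \<open>Rounding the image of \<open>x\<close> at time \<open>T\<close> to the grid
      gives a first reachable grid point.\<close>
    define k where "k = (\<lambda>c. \<lfloor>log_coords B b (\<phi> x T) c / \<eta>\<rfloor>)"
    have "\<bar>log_coords B b (\<phi> x T) c - grid_point \<eta> k c\<bar> \<le> 2 * e" for c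
    proof -
      let ?y = "log_coords B b (\<phi> x T) c"
      have "\<eta> * real_of_int \<lfloor>?y / \<eta>\<rfloor> \<le> \<eta> * (?y / \<eta>)" "\<eta> * (?y / \<eta>) \<le> \<eta> * (real_of_int \<lfloor>?y / \<eta>\<rfloor> + 1)"
        using \<eta> by (intro mult_left_mono; linarith)+
      then have "\<bar>?y - grid_point \<eta> k c\<bar> \<le> \<eta>"
        using \<eta> by (auto simp: k_def grid_point_def abs_le_iff algebra_simps)
      then show ?thesis
        using \<eta> e by linarith
    qed
    then have "?step x (softmax B (grid_point \<eta> k))"
      using x by (intro step) (auto simp: B_def)
    moreover have "k \<in> N"
      by (auto simp: N_def k_def log_coords_def)
    ultimately show ?thesis
      by (auto simp: R_def)
  qed
  \<comment> \<open>The case \<open>j = 0\<close> makes \<open>R\<close> invariant under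
    \<open>\<Psi>\<close>, the case \<open>j = 1\<close> adds the extra unit. The coordinate
    \<open>c\<close> must be free for the result to stay in \<open>N\<close>.\<close>
  have R_step: "(\<Psi> k)(c := \<Psi> k c + j) \<in> R"
    if k: "k \<in> R" and c: "c \<in> B" "snd c \<noteq> b (fst c)" and j: "j = 0 \<or> j = 1" for k c j
  proof -
    let ?z = "softmax B (grid_point \<eta> k)" and ?k' = "(\<Psi> k)(c := \<Psi> k c + j)"
    have kN: "k \<in> N"
      using k by (simp add: R_def)
    have near: "\<bar>log_coords B b (\<phi> ?z T) d - grid_point \<eta> (\<Psi> k) d\<bar> \<le> e" for d
      using log_coords_flow_has_derivative[of ?z] sm b flow_0[of ?z] log[OF kN]
      by (intro \<Psi>[rule_format]) auto
    have "\<bar>log_coords B b (\<phi> ?z T) d - grid_point \<eta> ?k' d\<bar> \<le> 2 * e" for d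
      using near[of d] \<eta> e(1) j by (auto simp: grid_point_def algebra_simps)
    then have "?step ?z (softmax B (grid_point \<eta> ?k'))"
      using sm by (intro step) auto
    moreover have "\<Psi> k (p, s) = k (p, s)" if "(p, s) \<notin> B \<or> s = b p" for p s
      using that by (intro \<Psi>_fixed[rule_format]) (auto simp: log_field_def)
    then have "?k' \<in> N"
      using kN c by (auto simp: N_def)
    ultimately show ?thesis
      using k by (auto simp: R_def)
  qed
  have "finite R"
  proof -
    define m where "m = \<lceil>\<bar>2 * ln \<delta>\<bar> / \<eta>\<rceil>"
    have "k c \<in> {-m..m}" if "k \<in> R" for k c
    proof -
      have "\<bar>log_coords B b (softmax B (grid_point \<eta> k)) c\<bar> \<le> \<bar>2 * ln \<delta>\<bar>"
        using that sm b \<delta> by (intro log_coords_bound[of _ S] interior) (auto simp: R_def)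
      then have "\<bar>\<eta> * real_of_int (k c)\<bar> \<le> \<bar>2 * ln \<delta>\<bar>"
        using that log by (simp add: R_def grid_point_def)
      then have "\<bar>real_of_int (k c)\<bar> \<le> \<bar>2 * ln \<delta>\<bar> / \<eta>"
        using \<eta> by (simp add: abs_mult field_simps)
      then show ?thesis
        unfolding m_def by simp linarith
    qed
    then have "R \<subseteq> {k. \<forall>c. (c \<in> UNIV \<longrightarrow> k c \<in> {-m..m}) \<and> (c \<notin> UNIV \<longrightarrow> k c = 0)}"
      by auto
    then show ?thesis
      by (rule finite_subset) (intro finite_set_of_finite_funs; simp)
  qed
  define c where "c = (p0, s0)"
  have c: "c \<in> B" "snd c \<noteq> b (fst c)"
    using mixed by (auto simp: c_def B_def b_def)
  have "\<Psi> ` R \<subseteq> R"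
    using R_step[OF _ c, of _ 0] by auto
  then have onto: "\<Psi> ` R = R"
    using \<open>finite R\<close> \<open>inj \<Psi>\<close> by (meson endo_inj_surj inj_on_subset subset_UNIV)
  \<comment> \<open>An element \<open>k\<close> of \<open>R\<close> with maximal coordinate
    \<open>c\<close> is an image under \<open>\<Psi>\<close>, so one unit more in that coordinate is
    also in \<open>R\<close>.\<close>
  have "finite ((\<lambda>k. k c) ` R)" "(\<lambda>k. k c) ` R \<noteq> {}"
    using \<open>finite R\<close> \<open>R \<noteq> {}\<close> by auto
  from Max_in[OF this] obtain k where k: "k \<in> R" "k c = Max ((\<lambda>k. k c) ` R)"
    by auto
  obtain l where l: "l \<in> R" "k = \<Psi> l"
    using onto k(1) by blast
  have "k(c := k c + 1) \<in> R"
    using R_step[OF l(1) c, of 1] l(2) by simp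
  then have "k c + 1 \<le> Max ((\<lambda>k. k c) ` R)"
    using \<open>finite R\<close> by (intro Max_ge) (auto intro: rev_image_eqI)
  then show False
    using k(2) by simp
qed

end


section \<open>Pure profiles and edges\<close>

definition pure_profile :: "('n \<Rightarrow> 's) \<Rightarrow> real^'s::finite^'n::finite" where
  "pure_profile q = (\<chi> i. axis (q i) 1)"

lemma pure_profile_in_strategy_space:
  "q \<in> profiles S \<Longrightarrow> pure_profile q \<in> strategy_space S"
  by (auto simp: strategy_space_def pure_profile_def axis_def profiles_def)

lemma expected_utility_pure_profile:
  assumes "q \<in> profiles S"
  shows "expected_utility S u (pure_profile q) = u q"
proof -
  have "(\<Prod>i\<in>UNIV. pure_profile q $ i $ r i) = (if r = q then 1 else 0)" for r
  proof (cases "r = q")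
    case False
    then obtain i where "r i \<noteq> q i" by auto
    then have "\<exists>i\<in>UNIV. pure_profile q $ i $ r i = 0"
      by (auto simp: pure_profile_def axis_def)
    then show ?thesis
      using False by simp
  qed (simp add: pure_profile_def axis_def)
  moreover have "finite (profiles S)"
    by (rule finite_subset[OF subset_UNIV finite])
  ultimately show ?thesis
    using assms by (simp add: expected_utility_def if_distrib[of "\<lambda>c. c *\<^sub>R u _"] cong: if_cong)
qed

lemma eq_pure_profile:
  assumes x: "x \<in> strategy_space S" and supp: "\<And>p s. (p, s) \<in> strategy_support x \<Longrightarrow> s = q p"
  shows "x = pure_profile q" "q \<in> profiles S"
proof -
  have eq: "{s. (p, s) \<in> strategy_support x} = {q p}" for p
    using supp ex_strategy_support[OF x, of p] by auto
  have "x $ p $ s = (if s = q p then 1 else 0)" for p s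
  proof (cases "s = q p")
    case True
    then show ?thesis
      using sum_strategy_support[OF x, of p] by (simp add: eq)
  next
    case False
    then have "(p, s) \<notin> strategy_support x"
      using supp by auto
    then show ?thesis
      using False strategy_space_coord_nonneg[OF x, of p s] by (simp add: strategy_support_def)
  qed
  then show "x = pure_profile q"
    by (simp add: pure_profile_def vec_eq_iff axis_def)
  show "q \<in> profiles S"
    using strategy_support_subset[OF x] eq by (auto simp: profiles_def)
qed

text \<open>For comparable \<open>p\<close> and \<open>q\<close> this runs along an edge of the
  strategy space: a single player mixes two strategies.\<close>

definition edge_point :: "('n \<Rightarrow> 's) \<Rightarrow> ('n \<Rightarrow> 's) \<Rightarrow> real \<Rightarrow> real^'s::finite^'n::finite" where
  "edge_point p q \<alpha> = (1 - \<alpha>) *\<^sub>R pure_profile p + \<alpha> *\<^sub>R pure_profile q"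

lemma edge_point_coord:
  "edge_point p q \<alpha> $ j $ s = (1 - \<alpha>) * (if s = p j then 1 else 0) + \<alpha> * (if s = q j then 1 else 0)"
  by (simp add: edge_point_def pure_profile_def axis_def)

lemma edge_point_in_strategy_space:
  fixes p q :: "'n::finite \<Rightarrow> 's::finite"
  assumes "p \<in> profiles S" "q \<in> profiles S" "0 \<le> \<alpha>" "\<alpha> \<le> 1"
  shows "edge_point p q \<alpha> \<in> strategy_space S"
  using assms by (auto simp: strategy_space_def edge_point_coord profiles_def sum.distrib
      simp flip: sum_distrib_left)

lemma dist_edge_point:
  fixes p q :: "'n::finite \<Rightarrow> 's::finite"
  shows "dist (edge_point p q \<alpha>) (edge_point p q \<mu>) \<le> real CARD('n) * real CARD('s) * \<bar>\<alpha> - \<mu>\<bar>"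
  by (rule dist_le_coords) (auto simp: edge_point_coord)

text \<open>The support condition leaves only the strategies of \<open>p\<close> and
  \<open>q\<close>; since the weights of each player sum to 1, the weight of \<open>q i\<close> is
  the only free parameter.\<close>

lemma eq_edge_point:
  assumes x: "x \<in> strategy_space S" and pq: "comparable i p q"
    and supp: "strategy_support x \<subseteq> strategy_support (edge_point p q \<alpha>)"
  shows "x = edge_point p q (x $ i $ q i)"
proof -
  have out: "x $ j $ s = 0" if "s \<noteq> p j" "s \<noteq> q j" for j s
  proof -
    have "(j, s) \<notin> strategy_support (edge_point p q \<alpha>)"
      using that by (simp add: strategy_support_def edge_point_coord)
    then show ?thesis
      using supp strategy_space_coord_nonneg[OF x, of j s]
      by (force simp: strategy_support_def)
  qed
  have sums: "(\<Sum>s\<in>{p j, q j}. x $ j $ s) = 1" for j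
  proof -
    have "(\<Sum>s\<in>{p j, q j}. x $ j $ s) = (\<Sum>s\<in>S j. x $ j $ s)"
      using x out by (intro sum.mono_neutral_cong) (auto simp: strategy_space_def)
    then show ?thesis
      using x by (simp add: strategy_space_def)
  qed
  have i: "x $ i $ p i + x $ i $ q i = 1"
    using sums[of i] pq by (simp add: comparable_def)
  have other: "q j = p j \<and> x $ j $ p j = 1" if "j \<noteq> i" for j
    using sums[of j] pq that by (simp add: comparable_def)
  have "x $ j $ s = edge_point p q (x $ i $ q i) $ j $ s" for j s
  proof (cases "j = i")
    case True
    have "p i \<noteq> q i" "x $ i $ p i = 1 - x $ i $ q i"
      using i pq by (auto simp: comparable_def)
    then show ?thesis
      using out[of s i] unfolding True edge_point_coord
      by (cases "s = p i"; cases "s = q i") simp_all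
  next
    case False
    then show ?thesis
      using out[of s j] other[OF False] unfolding edge_point_coord by (cases "s = p j") simp_all
  qed
  then show ?thesis
    unfolding vec_eq_iff by blast
qed

lemma play_pure_edge_point:
  assumes "comparable i p q"
  shows "play_pure (edge_point p q \<alpha>) i s = pure_profile (p(i := s))"
proof -
  have "edge_point p q \<alpha> $ j = axis (p j) 1" if "j \<noteq> i" for j
    using assms that by (simp add: edge_point_def pure_profile_def comparable_def flip: scaleR_add_left)
  then show ?thesis
    by (simp add: play_pure_def pure_profile_def vec_eq_iff)
qed

section \<open>Chains to and between pure profiles\<close>

context replicator_system
begin

lemma reaches_pure_profile:
  assumes "x \<in> strategy_space S" "\<epsilon> > 0" "T > 0"
  shows "\<exists>q\<in>profiles S. (chain_step (strategy_space S) \<phi> \<epsilon> T)\<^sup>*\<^sup>* x (pure_profile q)"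
  using assms(1)
proof (induction "card (strategy_support x)" arbitrary: x rule: less_induct)
  case less
  show ?case
  proof (cases "\<exists>p s a. (p, s) \<in> strategy_support x \<and> (p, a) \<in> strategy_support x \<and> s \<noteq> a")
    case True
    then obtain z where z: "(chain_step (strategy_space S) \<phi> \<epsilon> T)\<^sup>*\<^sup>* x z" "z \<in> strategy_space S"
      "strategy_support z \<subset> strategy_support x"
      using reaches_smaller_support[OF less.prems assms(2,3)] by blast
    have "card (strategy_support z) < card (strategy_support x)"
      using z(3) by (intro psubset_card_mono) auto
    from less.hyps[OF this z(2)] show ?thesis
      using z(1) by (meson rtranclp_trans)
  next
    case False
    define q where "q = (\<lambda>p. SOME s. (p, s) \<in> strategy_support x)"
    have "(p, q p) \<in> strategy_support x" for p
      using ex_strategy_support[OF less.prems, of p] by (auto simp: q_def intro: someI_ex)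
    then have "s = q p" if "(p, s) \<in> strategy_support x" for p s
      using False that by blast
    from eq_pure_profile[where q = q, OF less.prems this] show ?thesis
      by auto
  qed
qed

text \<open>Edges are invariant because supports are. On the edge the weight \<open>\<mu>\<close> of
  \<open>q i\<close> obeys a logistic equation with right-hand side
  \<open>\<mu> * (1 - \<mu>) * (u q $ i - u p $ i)\<close>, which is non-negative.\<close>

lemma flow_edge_point:
  assumes p: "p \<in> profiles S" and q: "q \<in> profiles S" and pq: "comparable i p q"
    and le: "u p $ i \<le> u q $ i" and \<alpha>: "0 \<le> \<alpha>" "\<alpha> \<le> 1" and "t \<ge> 0"
  obtains \<mu> where "\<alpha> \<le> \<mu>" "\<mu> \<le> 1" "\<phi> (edge_point p q \<alpha>) t = edge_point p q \<mu>"
proof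
  let ?x = "edge_point p q \<alpha>"
  define \<mu> where "\<mu> = (\<lambda>t. \<phi> ?x t $ i $ q i)"
  have x: "?x \<in> strategy_space S"
    using edge_point_in_strategy_space p q \<alpha> by blast
  have edge: "\<phi> ?x t = edge_point p q (\<mu> t)" if "t \<ge> 0" for t
    unfolding \<mu>_def
    using eq_edge_point[OF flow_in_strategy_space[OF x, of t] pq, of \<alpha>] strategy_support_flow[OF x that]
    by simp
  have \<mu>: "0 \<le> \<mu> t" "\<mu> t \<le> 1" for t
    using strategy_space_coord_nonneg[OF flow_in_strategy_space[OF x]]
      strategy_space_coord_le_1[OF flow_in_strategy_space[OF x]]
    by (simp_all add: \<mu>_def)
  have upd: "p(i := q i) = q"
    using pq by (auto simp: comparable_def)
  have growth: "growth i (q i) (edge_point p q \<nu>) = (1 - \<nu>) * (u q $ i - u p $ i)" for \<nu>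
  proof -
    have pay: "expected_pure S u i s (edge_point p q \<nu>) = u (p(i := s)) $ i" if "s \<in> S i" for s
      using that p by (simp add: expected_pure_def play_pure_edge_point[OF pq] profiles_def
          expected_utility_pure_profile)
    have "p i \<in> S i" "q i \<in> S i"
      using p q by (auto simp: profiles_def)
    then have "(\<Sum>t\<in>S i. edge_point p q \<nu> $ i $ t * expected_pure S u i t (edge_point p q \<nu>))
        = (1 - \<nu>) * u p $ i + \<nu> * u q $ i"
      by (simp add: pay edge_point_coord distrib_right sum.distrib upd if_distrib[of "\<lambda>c. _ * c"]
          if_distrib[of "\<lambda>c. c * _"] cong: if_cong)
    then show ?thesis
      using \<open>q i \<in> S i\<close> by (simp add: growth_def pay upd algebra_simps)
  qed
  have "\<mu> 0 \<le> \<mu> t"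
  proof (rule DERIV_nonneg_imp_nondecreasing[OF \<open>t \<ge> 0\<close>])
    fix \<tau> :: real
    assume "0 \<le> \<tau>"
    have "(\<mu> has_real_derivative \<mu> \<tau> * growth i (q i) (\<phi> ?x \<tau>)) (at \<tau>)"
      using flow_coord_has_derivative[OF x] unfolding \<mu>_def .
    then have "(\<mu> has_real_derivative \<mu> \<tau> * ((1 - \<mu> \<tau>) * (u q $ i - u p $ i))) (at \<tau>)"
      by (simp only: edge[OF \<open>0 \<le> \<tau>\<close>] growth)
    moreover have "0 \<le> \<mu> \<tau> * ((1 - \<mu> \<tau>) * (u q $ i - u p $ i))"
      using \<mu>[of \<tau>] le by simp
    ultimately show "\<exists>y. (\<mu> has_real_derivative y) (at \<tau>) \<and> 0 \<le> y"
      by blast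
  qed
  moreover have "q i \<noteq> p i"
    using pq by (auto simp: comparable_def)
  then have "\<mu> 0 = \<alpha>"
    by (simp add: \<mu>_def flow_0[OF x] edge_point_coord)
  ultimately show "\<alpha> \<le> \<mu> t"
    by simp
  show "\<mu> t \<le> 1" "\<phi> ?x t = edge_point p q (\<mu> t)"
    using \<mu> edge[OF \<open>t \<ge> 0\<close>] by auto
qed

lemma reaches_along_arc:
  assumes arc: "p \<rightarrow>\<^bsub>response_graph S u\<^esub> q" and "\<epsilon> > 0" "T > 0"
  shows "(chain_step (strategy_space S) \<phi> \<epsilon> T)\<^sup>*\<^sup>* (pure_profile p) (pure_profile q)"
proof -
  let ?step = "chain_step (strategy_space S) \<phi> \<epsilon> T"
  obtain i where p: "p \<in> profiles S" and q: "q \<in> profiles S" and pq: "comparable i p q"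
    and le: "u p $ i \<le> u q $ i"
    using arc by (auto simp: dominates_response_graph_iff)
  define W where "W = real CARD('n) * real CARD('s)"
  have W: "W > 0"
    by (simp add: W_def)
  define \<gamma> where "\<gamma> = \<epsilon> / (2 * W)"
  have \<gamma>: "\<gamma> > 0" "W * \<gamma> < \<epsilon>"
    using W \<open>\<epsilon> > 0\<close> by (auto simp: \<gamma>_def)
  \<comment> \<open>Each round flows for time \<open>T\<close>, which loses no weight on
    \<open>q\<close>, and then jumps by up to \<open>\<gamma>\<close> towards \<open>q\<close>. The
    jumps are essential, since the flow alone never leaves \<open>pure_profile p\<close>.\<close>
  have "\<exists>\<alpha>. min 1 (real k * \<gamma>) \<le> \<alpha> \<and> \<alpha> \<le> 1 \<and> ?step\<^sup>*\<^sup>* (edge_point p q 0) (edge_point p q \<alpha>)" for k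
  proof (induction k)
    case 0
    show ?case
      by (intro exI[of _ 0]) simp
  next
    case (Suc k)
    then obtain \<alpha> where \<alpha>: "min 1 (real k * \<gamma>) \<le> \<alpha>" "\<alpha> \<le> 1"
      and reach: "?step\<^sup>*\<^sup>* (edge_point p q 0) (edge_point p q \<alpha>)"
      by blast
    have "0 \<le> \<alpha>"
      using \<alpha>(1) \<gamma> by (auto simp: min_def split: if_splits intro: order.trans[rotated])
    then obtain \<mu> where \<mu>: "\<alpha> \<le> \<mu>" "\<mu> \<le> 1" "\<phi> (edge_point p q \<alpha>) T = edge_point p q \<mu>"
      using flow_edge_point[OF p q pq le, of \<alpha> T] \<alpha>(2) \<open>T > 0\<close> by auto
    define \<nu> where "\<nu> = min 1 (\<mu> + \<gamma>)"
    have "\<bar>\<mu> - \<nu>\<bar> \<le> \<gamma>"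
      using \<mu> \<gamma> by (auto simp: \<nu>_def)
    then have "W * \<bar>\<mu> - \<nu>\<bar> \<le> W * \<gamma>"
      using W by simp
    then have "dist (edge_point p q \<mu>) (edge_point p q \<nu>) < \<epsilon>"
      using dist_edge_point[of p q \<mu> \<nu>, folded W_def] \<gamma>(2) by linarith
    moreover have "edge_point p q \<alpha> \<in> strategy_space S" "edge_point p q \<nu> \<in> strategy_space S"
      using \<open>0 \<le> \<alpha>\<close> \<alpha> \<mu> \<gamma> by (auto intro!: edge_point_in_strategy_space p q simp: \<nu>_def)
    ultimately have "?step (edge_point p q \<alpha>) (edge_point p q \<nu>)"
      unfolding chain_step_def using \<mu>(3) by (metis order_refl)
    then show ?case
      using reach \<alpha> \<mu> \<gamma> by (intro exI[of _ \<nu>]) (auto simp: \<nu>_def algebra_simps min_def split: if_splits)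
  qed
  moreover obtain k where "real k > 1 / \<gamma>"
    using reals_Archimedean2 by blast
  then have "min 1 (real k * \<gamma>) = 1"
    using \<gamma> by (simp add: field_simps)
  ultimately have "?step\<^sup>*\<^sup>* (edge_point p q 0) (edge_point p q 1)"
    by (metis order_antisym)
  then show ?thesis
    by (simp add: edge_point_def)
qed

lemma reaches_along_path:
  assumes "p \<rightarrow>\<^sup>*\<^bsub>response_graph S u\<^esub> q" and "\<epsilon> > 0" "T > 0"
  shows "(chain_step (strategy_space S) \<phi> \<epsilon> T)\<^sup>*\<^sup>* (pure_profile p) (pure_profile q)"
  using assms(1) unfolding reachable_def
proof (induction rule: rtrancl_on_induct)
  case (step q r)
  then show ?case
    using reaches_along_arc[of q r, OF _ assms(2,3)] by (meson rtranclp_trans)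
qed simp

lemma pseudo_orbit_to_pure_profile:
  assumes x: "x \<in> strategy_space S"
    and h: "\<And>q. q \<in> profiles S \<Longrightarrow> q \<rightarrow>\<^sup>*\<^bsub>response_graph S u\<^esub> h"
  shows "pseudo_orbit (strategy_space S) \<phi> x (pure_profile h)"
  unfolding pseudo_orbit_def chain_from_to_iff_tranclp
proof (intro allI impI)
  fix \<epsilon> T :: real
  assume "\<epsilon> > 0" "T > 0"
  let ?step = "chain_step (strategy_space S) \<phi> \<epsilon> T"
  \<comment> \<open>An initial exact flow step guarantees a non-empty chain, even when
    \<open>x\<close> already is the target.\<close>
  have "?step x (\<phi> x T)"
    unfolding chain_step_def using x flow_in_strategy_space \<open>\<epsilon> > 0\<close>
    by (intro conjI exI[of _ T]) auto
  moreover obtain q where "q \<in> profiles S" "?step\<^sup>*\<^sup>* (\<phi> x T) (pure_profile q)"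
    using reaches_pure_profile[OF flow_in_strategy_space[OF x] \<open>\<epsilon> > 0\<close> \<open>T > 0\<close>] by blast
  moreover from this have "?step\<^sup>*\<^sup>* (pure_profile q) (pure_profile h)"
    using reaches_along_path[OF h \<open>\<epsilon> > 0\<close> \<open>T > 0\<close>] by blast
  ultimately show "?step\<^sup>+\<^sup>+ x (pure_profile h)"
    by (meson rtranclp_into_tranclp2 rtranclp_trans)
qed

end

theorem lemma5p7:
  fixes S :: "'n::finite \<Rightarrow> 's::finite set"
    and u :: "('n \<Rightarrow> 's) \<Rightarrow> real^'n"
  assumes "game S"
    and "preference_zero_sum S u"
  shows "(\<exists>!H. sink_connected_component (response_graph S u) H) \<and>
         (\<forall>\<phi>. replicator_flow S u \<phi> \<longrightarrow> (\<exists>!C. sink_chain_component (strategy_space S) \<phi> C))"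
proof (intro conjI allI impI)
  note Int = preference_zero_sum_attracting_Int_nonempty[OF assms(2)]
  show sink: "\<exists>!H. sink_connected_component (response_graph S u) H"
    by (rule ex1_sink_connected_component)
      (simp_all add: finite_profiles profiles_nonempty assms(1) Int)
  fix \<phi>
  assume "replicator_flow S u \<phi>"
  then interpret replicator_system S u \<phi>
    by unfold_locales
  \<comment> \<open>Any profile \<open>h\<close> of the sink component can serve as the common
    target of all pseudo-orbits.\<close>
  obtain H h where H: "sink_connected_component (response_graph S u) H" and h: "h \<in> H"
    using sink by (auto simp: sink_connected_component_def)
  have hS: "h \<in> profiles S"
    using H h by (auto simp: sink_connected_component_def attracting_def)
  have "q \<rightarrow>\<^sup>*\<^bsub>response_graph S u\<^esub> h" if "q \<in> profiles S" for q
    using sink_connected_component_reachable[OF H Int h] that by simp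
  then have "pseudo_orbit (strategy_space S) \<phi> x (pure_profile h)" if "x \<in> strategy_space S" for x
    using pseudo_orbit_to_pure_profile that by blast
  then show "\<exists>!C. sink_chain_component (strategy_space S) \<phi> C"
    by (rule ex1_sink_chain_component[OF pure_profile_in_strategy_space[OF hS]])
qed

end
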